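(* Let $D=(V_1,V_2;A)$ be a 2-arc-strong split digraph such that $V_1$ is independent and $D\langle V_2\rangle$ is semicomplete. Suppose that every vertex of $V_1$ has both in-degree and out-degree at least $3$ in $D$. Then $D$ has a good $(u,v)$-pair for every choice of vertices $u,v$ of $D$.
   Context: Digraphs have no loops and no parallel arcs. A digraph is semicomplete if every two distinct vertices are joined by at least one arc. A split digraph $D=(V_1,V_2;A)$ is a digraph whose vertex set is the disjoint union of two non-empty sets $V_1,V_2$ such that $V_1$ is independent and the subdigraph $D\langle V_2\rangle$ induced by $V_2$ is semicomplete. A digraph is strong if there is a directed path between every ordered pair of distinct vertices; it is $k$-arc-strong if it stays strong after deleting any at most $k-1$ arcs. An out-branching (resp. in-branching) of $D$ rooted at $r$ is a spanning oriented tree in which every vertex except $r$ has in-degree (resp. out-degree) exactly one. A good $(u,v)$-pair is a pair consisting of an out-branching rooted at $u$ and an in-branching rooted at $v$ that are arc-disjoint. *)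

theory Defs
  imports "Graph_Theory.Graph_Theory"
begin

text \<open>
  The locale \<^locale>\<open>digraph\<close> of the library describes finite digraphs without loops and without
  parallel arcs; a pair of opposite arcs is allowed.
\<close>

definition independent_in :: "('a, 'b) pre_digraph \<Rightarrow> 'a set \<Rightarrow> bool" where
  "independent_in D X \<longleftrightarrow> X \<subseteq> verts D \<and> (\<forall>u \<in> X. \<forall>v \<in> X. \<not> u \<rightarrow>\<^bsub>D\<^esub> v)"

definition semicomplete :: "('a, 'b) pre_digraph \<Rightarrow> bool" where
  "semicomplete D \<longleftrightarrow> digraph D \<and>
    (\<forall>u \<in> verts D. \<forall>v \<in> verts D. u \<noteq> v \<longrightarrow> u \<rightarrow>\<^bsub>D\<^esub> v \<or> v \<rightarrow>\<^bsub>D\<^esub> u)"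

definition split_digraph :: "('a, 'b) pre_digraph \<Rightarrow> 'a set \<Rightarrow> 'a set \<Rightarrow> bool" where
  "split_digraph D V1 V2 \<longleftrightarrow> digraph D \<and> verts D = V1 \<union> V2 \<and> V1 \<inter> V2 = {} \<and>
    V1 \<noteq> {} \<and> V2 \<noteq> {} \<and> independent_in D V1 \<and> semicomplete (D \<restriction> V2)"

definition del_arcs :: "('a, 'b) pre_digraph \<Rightarrow> 'b set \<Rightarrow> ('a, 'b) pre_digraph" where
  "del_arcs D S = D\<lparr>arcs := arcs D - S\<rparr>"

definition arc_strong :: "nat \<Rightarrow> ('a, 'b) pre_digraph \<Rightarrow> bool" where
  "arc_strong k D \<longleftrightarrow>
    (\<forall>S \<subseteq> arcs D. finite S \<and> card S < k \<longrightarrow> strongly_connected (del_arcs D S))"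

text \<open>
  An oriented tree is an orientation of an undirected tree. The library's \<^const>\<open>tree\<close> only excludes
  directed cycles, so it is not used here. Cycles of the underlying undirected graph are
  the directed cycles of length at least three of \<^term>\<open>mk_symmetric T\<close>: there each edge is a
  pair of opposite arcs, which the library counts as a cycle of length two. Since
  \<^const>\<open>mk_symmetric\<close> identifies opposite arcs of \<open>T\<close> these have to be excluded separately.
\<close>

definition oriented_tree :: "('a, 'b) pre_digraph \<Rightarrow> bool" where
  "oriented_tree T \<longleftrightarrow> digraph T \<and> (\<forall>u v. u \<rightarrow>\<^bsub>T\<^esub> v \<longrightarrow> \<not> v \<rightarrow>\<^bsub>T\<^esub> u) \<and>
    connected T \<and> (\<nexists>p. pre_digraph.cycle (with_proj (mk_symmetric T)) p \<and> length p \<ge> 3)"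

definition out_branching :: "('a, 'b) pre_digraph \<Rightarrow> 'a \<Rightarrow> ('a, 'b) pre_digraph \<Rightarrow> bool" where
  "out_branching D r B \<longleftrightarrow> spanning B D \<and> oriented_tree B \<and> r \<in> verts B \<and>
    (\<forall>w \<in> verts B. w \<noteq> r \<longrightarrow> in_degree B w = 1)"

definition in_branching :: "('a, 'b) pre_digraph \<Rightarrow> 'a \<Rightarrow> ('a, 'b) pre_digraph \<Rightarrow> bool" where
  "in_branching D r B \<longleftrightarrow> spanning B D \<and> oriented_tree B \<and> r \<in> verts B \<and>
    (\<forall>w \<in> verts B. w \<noteq> r \<longrightarrow> out_degree B w = 1)"

definition good_pair ::
  "('a, 'b) pre_digraph \<Rightarrow> 'a \<Rightarrow> 'a \<Rightarrow> ('a, 'b) pre_digraph \<Rightarrow> ('a, 'b) pre_digraph \<Rightarrow> bool" where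
  "good_pair D u v B_out B_in \<longleftrightarrow>
    out_branching D u B_out \<and> in_branching D v B_in \<and> arcs B_out \<inter> arcs B_in = {}"

end

theory Submission
  imports Defs
begin

text \<open>
  It suffices to colour the arcs red and blue such that \<open>u\<close> reaches every vertex along red arcs
  and every vertex reaches \<open>v\<close> along blue ones. Suppose first that \<open>u\<close> and \<open>v\<close> lie in \<open>V2\<close>.
  Vertices dominated by \<open>v\<close> can be made red through \<open>v\<close> and vertices dominating \<open>u\<close> or \<open>v\<close> can be
  made blue directly, so only a red forest covering the vertices not dominated by \<open>v\<close>, and a
  blue path from the set \<open>S\<close> of vertices dominating neither root, have to be found. Since \<open>S\<close> is
  semicomplete, one vertex \<open>w\<close> of \<open>S\<close> is reached from all of \<open>S\<close>, and Lovasz' proof of Edmonds' branching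
  theorem yields a blue path from \<open>w\<close> to \<open>v\<close> that is arc-disjoint from such a forest. Which red arcs
  between \<open>u\<close> and \<open>v\<close> have to be reserved depends on whether \<open>v\<close> is reached from \<open>u\<close> by a path with one or
  two arcs. A root \<open>u\<close> in \<open>V1\<close> is replaced by a suitable out-neighbour \<open>p\<close>. When both roots lie in
  \<open>V1\<close>, the arc from some in-neighbour \<open>q\<close> of \<open>v\<close> to \<open>v\<close> can be deleted without destroying 2-arc-strength
  and \<open>q\<close> replaces \<open>v\<close>, or dually for \<open>u\<close>; the only exception is that the in-neighbours of \<open>v\<close> and the
  out-neighbours of \<open>u\<close> both induce a directed triangle with no other arcs leaving, respectively entering, it
  except for those to \<open>v\<close>, respectively from \<open>u\<close>, and then an explicit colouring works.
\<close>

abbreviation (input) entering :: "'a rel \<Rightarrow> 'a set \<Rightarrow> 'a rel" where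
  "entering E X \<equiv> E \<inter> (- X) \<times> X"

section \<open>Arc-disjoint trees\<close>

lemma reachable_if_entering:
  assumes "E \<subseteq> V \<times> V"
    and "\<And>X. X \<subseteq> V \<Longrightarrow> X \<noteq> {} \<Longrightarrow> X \<inter> R = {} \<Longrightarrow> entering E X \<noteq> {}"
  shows "V \<subseteq> E\<^sup>* `` R"
proof (rule ccontr)
  let ?X = "V - E\<^sup>* `` R"
  assume "\<not> V \<subseteq> E\<^sup>* `` R"
  then have "?X \<noteq> {}" "?X \<subseteq> V" "?X \<inter> R = {}" by auto
  then obtain a b where "(a, b) \<in> E" "a \<notin> ?X" "b \<in> ?X" using assms(2)[of ?X] by auto
  then show False using assms(1) by (auto intro: rtrancl_into_rtrancl)
qed

lemma entering_if_reachable: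
  assumes "(r, x) \<in> E\<^sup>*" "r \<notin> X" "x \<in> X"
  shows "entering E X \<noteq> {}"
  using assms by (induction rule: rtrancl_induct) auto

text \<open>Breadth-first search: \<open>f\<close> is the distance from \<open>R\<close>, and each
  reached vertex outside \<open>R\<close> selects one parent at smaller distance. The strict
  increase of \<open>f\<close> serves later for inductions along the forest and for excluding
  undirected cycles.\<close>

lemma out_forest:
  fixes L :: "'a rel"
  obtains P :: "'a rel" and f :: "'a \<Rightarrow> nat"
  where "P \<subseteq> L" "single_valued (P\<inverse>)" "\<And>a b. (a, b) \<in> P \<Longrightarrow> f a < f b"
    "\<And>a b. (a, b) \<in> P \<Longrightarrow> b \<notin> R" "\<And>a b. (a, b) \<in> P \<Longrightarrow> b \<in> L\<^sup>* `` R" "L\<^sup>* `` R \<subseteq> P\<^sup>* `` R"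
proof -
  define f where "f x = (LEAST n. \<exists>r\<in>R. (r, x) \<in> L ^^ n)" for x
  \<comment> \<open>On unreached vertices \<open>f\<close> is a \<open>LEAST\<close> over an empty
    set, so parents are required to be reached themselves.\<close>
  define Q where "Q a b \<longleftrightarrow> (a, b) \<in> L \<and> a \<in> L\<^sup>* `` R \<and> f a < f b" for a b
  define P where "P = {(a, b). b \<in> L\<^sup>* `` R \<and> b \<notin> R \<and> Q a b \<and> a = (SOME a. Q a b)}"
  have ex: "\<exists>a. Q a b" if b: "b \<in> L\<^sup>* `` R" "b \<notin> R" for b
  proof -
    have "\<exists>n. \<exists>r\<in>R. (r, b) \<in> L ^^ n" using b(1) by (force simp: rtrancl_power)
    then have "\<exists>r\<in>R. (r, b) \<in> L ^^ f b" unfolding f_def by (rule LeastI_ex)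
    then obtain r where r: "r \<in> R" "(r, b) \<in> L ^^ f b" by auto
    then obtain m where m: "f b = Suc m" using b(2) by (cases "f b") auto
    then obtain a where a: "(r, a) \<in> L ^^ m" "(a, b) \<in> L" using r by auto
    have "f a \<le> m" unfolding f_def using a(1) r(1) by (auto intro: Least_le)
    moreover have "a \<in> L\<^sup>* `` R" using a(1) r(1) relpow_imp_rtrancl by blast
    ultimately show ?thesis using a r m unfolding Q_def by auto
  qed
  have reach: "b \<in> L\<^sup>* `` R \<Longrightarrow> b \<in> P\<^sup>* `` R" for b
  proof (induction "f b" arbitrary: b rule: less_induct)
    case less
    show ?case
    proof (cases "b \<in> R")
      case False
      define a where "a = (SOME a. Q a b)"
      have "Q a b" using ex[OF less.prems False] unfolding a_def by (rule someI_ex)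
      then have "(a, b) \<in> P" "a \<in> P\<^sup>* `` R"
        using False less unfolding P_def a_def Q_def by auto
      then show ?thesis by (auto intro: rtrancl_into_rtrancl)
    qed auto
  qed
  have "L\<^sup>* `` R \<subseteq> P\<^sup>* `` R" using reach by blast
  then show thesis
    by (intro that[of P f]) (auto simp: P_def Q_def single_valued_def)
qed

text \<open>An arc entering \<open>X \<inter> Y\<close> or \<open>X \<union> Y\<close> enters
  \<open>X\<close> or \<open>Y\<close>, and an arc entering both of the former enters both of the
  latter.\<close>

lemma entering_submodular:
  assumes "finite G"
  shows "card (entering G (X \<inter> Y)) + card (entering G (X \<union> Y)) \<le> card (entering G X) + card (entering G Y)"
proof -
  let ?e = "\<lambda>X. entering G X"
  have fin: "finite (?e X)" for X using assms by auto
  have "card (?e (X \<inter> Y) \<union> ?e (X \<union> Y)) \<le> card (?e X \<union> ?e Y)"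
    using fin by (intro card_mono) auto
  moreover have "card (?e (X \<inter> Y) \<inter> ?e (X \<union> Y)) \<le> card (?e X \<inter> ?e Y)"
    using fin by (intro card_mono) auto
  ultimately show ?thesis
    using card_Un_Int[OF fin[of X] fin[of Y]] card_Un_Int[OF fin[of "X \<inter> Y"] fin[of "X \<union> Y"]] by linarith
qed

text \<open>
  Lovasz' proof of Edmonds' branching theorem: a tree grown from \<open>w\<close> can be extended by an
  arc inside an inclusion-minimal tight set that leaves the tree.
\<close>

lemma tree_step:
  assumes fin: "finite V" and EV: "E \<subseteq> V \<times> V"
    and two: "\<And>X. X \<subseteq> V \<Longrightarrow> X \<noteq> {} \<Longrightarrow> X \<inter> R = {} \<Longrightarrow> w \<notin> X \<Longrightarrow> 2 \<le> card (entering E X)"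
    and one: "\<And>X. X \<subseteq> V \<Longrightarrow> X \<noteq> {} \<Longrightarrow> w \<notin> X \<Longrightarrow> entering E X \<noteq> {}"
    and A: "A \<subseteq> V" "w \<in> A" "A \<noteq> V" and F: "F \<subseteq> A \<times> A"
    and inv: "\<And>X. X \<subseteq> V \<Longrightarrow> X \<noteq> {} \<Longrightarrow> X \<inter> R = {} \<Longrightarrow> entering (E - F) X \<noteq> {}"
  shows "\<exists>a b. (a, b) \<in> E \<and> a \<in> A \<and> b \<in> V - A \<and>
    (\<forall>X. X \<subseteq> V \<longrightarrow> X \<noteq> {} \<longrightarrow> X \<inter> R = {} \<longrightarrow> entering (E - insert (a, b) F) X \<noteq> {})"
proof -
  let ?d = "\<lambda>X. card (entering (E - F) X)"
  have finE: "finite E" using fin EV finite_subset by blast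
  then have finc: "finite (entering G X)" if "G \<subseteq> E" for G X using that finite_subset by blast
  define tight where "tight X \<longleftrightarrow> X \<subseteq> V \<and> X \<inter> R = {} \<and> \<not> X \<subseteq> A \<and> ?d X = 1" for X
  have ge1: "1 \<le> ?d X" if "X \<subseteq> V" "X \<noteq> {}" "X \<inter> R = {}" for X
    using inv[OF that] finc[of "E - F" X] by (simp add: Suc_le_eq card_gt_0_iff)
  \<comment> \<open>Growing the tree by \<open>(a, b)\<close> fails only if \<open>(a, b)\<close> is
    the last arc outside \<open>F\<close> that enters some tight set.\<close>
  have bad: "tight X" "a \<notin> X" if X: "X \<subseteq> V" "X \<noteq> {}" "X \<inter> R = {}" "b \<in> V - A"
    and no: "entering (E - insert (a, b) F) X = {}" for a b X
  proof -
    have sub: "entering (E - F) X \<subseteq> {(a, b)}" using no by auto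
    then have "?d X \<le> 1" using card_mono[OF _ sub] by simp
    then have "?d X = 1" using ge1[OF X(1-3)] by simp
    moreover have "entering (E - F) X \<noteq> {}" using inv[OF X(1-3)] .
    then have "(a, b) \<in> entering (E - F) X" using sub by auto
    ultimately show "tight X" "a \<notin> X" using X unfolding tight_def by auto
  qed
  show ?thesis
  proof (cases "\<exists>X. tight X")
    case False
    have "entering E (V - A) \<noteq> {}" using one[of "V - A"] A by auto
    then obtain a b where "(a, b) \<in> E" "a \<in> A" "b \<in> V - A" using EV by auto
    then show ?thesis using bad(1) False by blast
  next
    case True
    define X where "X = arg_min card tight"
    have X: "tight X" and min: "\<And>Y. tight Y \<Longrightarrow> card X \<le> card Y"
      using True unfolding X_def by (auto intro: arg_min_natI arg_min_nat_le)
    \<comment> \<open>No arc of \<open>F\<close> enters \<open>X - A\<close>, so at least two of the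
      remaining arcs do, whereas only one enters \<open>X\<close>. Hence one of them starts in
      \<open>X \<inter> A\<close>.\<close>
    have "entering (E - F) (X - A) = entering E (X - A)" using F by auto
    then have "2 \<le> ?d (X - A)" using two[of "X - A"] X A unfolding tight_def by auto
    then have "\<not> entering (E - F) (X - A) \<subseteq> entering (E - F) X"
      using X card_mono[OF finc[of "E - F" X], of "entering (E - F) (X - A)"] unfolding tight_def by auto
    then obtain a b where ab: "(a, b) \<in> E" "a \<in> X \<inter> A" "b \<in> X - A" by auto
    have "entering (E - insert (a, b) F) Y \<noteq> {}" if Y: "Y \<subseteq> V" "Y \<noteq> {}" "Y \<inter> R = {}" for Y
    proof
      assume no: "entering (E - insert (a, b) F) Y = {}"
      have XV: "X \<subseteq> V" using X unfolding tight_def by auto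
      have Yt: "tight Y" "a \<notin> Y" using bad[OF Y _ no] ab XV by auto
      have "b \<in> Y" using no inv[OF Y] by auto
      then have ne: "X \<inter> Y \<subseteq> V" "X \<inter> Y \<noteq> {}" "(X \<inter> Y) \<inter> R = {}" "X \<union> Y \<subseteq> V" "X \<union> Y \<noteq> {}" "(X \<union> Y) \<inter> R = {}"
        using X Yt ab unfolding tight_def by auto
      \<comment> \<open>Submodularity leaves exactly one arc entering \<open>X \<inter> Y\<close>,
        so this set is tight; it misses \<open>a\<close>, against the minimality of
        \<open>X\<close>.\<close>
      have "?d (X \<inter> Y) + ?d (X \<union> Y) \<le> ?d X + ?d Y"
        using entering_submodular[of "E - F"] finE by auto
      then have "?d (X \<inter> Y) = 1" using ge1[OF ne(1-3)] ge1[OF ne(4-6)] X Yt unfolding tight_def by auto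
      then have "tight (X \<inter> Y)" using ne ab \<open>b \<in> Y\<close> unfolding tight_def by auto
      moreover have "card (X \<inter> Y) < card X"
        using ab Yt XV by (intro psubset_card_mono) (auto intro: finite_subset[OF _ fin])
      ultimately show False using min[of "X \<inter> Y"] by auto
    qed
    then show ?thesis using ab X unfolding tight_def by blast
  qed
qed

text \<open>Edmonds' theorem for the two root sets \<open>{w}\<close> and \<open>R\<close>: only a
  set avoiding both has to be entered twice. While the tree grows from \<open>w\<close>, every set
  avoiding \<open>R\<close> keeps an entering arc outside the tree, which in the end amounts to
  reachability from \<open>R\<close>.\<close>

lemma arc_disjoint_tree:
  assumes fin: "finite V" and EV: "E \<subseteq> V \<times> V" and w: "w \<in> V"
    and two: "\<And>X. X \<subseteq> V \<Longrightarrow> X \<noteq> {} \<Longrightarrow> X \<inter> R = {} \<Longrightarrow> w \<notin> X \<Longrightarrow> 2 \<le> card (entering E X)"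
    and oneR: "\<And>X. X \<subseteq> V \<Longrightarrow> X \<noteq> {} \<Longrightarrow> X \<inter> R = {} \<Longrightarrow> entering E X \<noteq> {}"
    and one: "\<And>X. X \<subseteq> V \<Longrightarrow> X \<noteq> {} \<Longrightarrow> w \<notin> X \<Longrightarrow> entering E X \<noteq> {}"
  obtains F where "F \<subseteq> E" "\<And>x. x \<in> V \<Longrightarrow> (w, x) \<in> F\<^sup>*" "V \<subseteq> (E - F)\<^sup>* `` R"
proof -
  have "\<exists>F'\<subseteq>E. (\<forall>x\<in>V. (w, x) \<in> F'\<^sup>*) \<and> V \<subseteq> (E - F')\<^sup>* `` R"
    if "A \<subseteq> V" "w \<in> A" "F \<subseteq> A \<times> A" "F \<subseteq> E" "\<forall>x\<in>A. (w, x) \<in> F\<^sup>*"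
      "\<And>X. X \<subseteq> V \<Longrightarrow> X \<noteq> {} \<Longrightarrow> X \<inter> R = {} \<Longrightarrow> entering (E - F) X \<noteq> {}" for A F
    using that
  proof (induction "card (V - A)" arbitrary: A F rule: less_induct)
    case less
    show ?case
    proof (cases "A = V")
      case True
      then have "V \<subseteq> (E - F)\<^sup>* `` R" using less.prems(6) EV by (intro reachable_if_entering) auto
      then show ?thesis using less.prems True by blast
    next
      case False
      obtain a b where ab: "(a, b) \<in> E" "a \<in> A" "b \<in> V - A"
        and inv: "\<And>X. X \<subseteq> V \<Longrightarrow> X \<noteq> {} \<Longrightarrow> X \<inter> R = {} \<Longrightarrow> entering (E - insert (a, b) F) X \<noteq> {}"
        using tree_step[OF fin EV two one less.prems(1,2) False less.prems(3,6)] by blast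
      have "card (V - insert b A) < card (V - A)" using ab fin by (intro psubset_card_mono) auto
      moreover have "(w, b) \<in> (insert (a, b) F)\<^sup>*"
        using ab less.prems(5) by (meson insertI1 rtrancl.rtrancl_into_rtrancl rtrancl_mono subsetD subset_insertI)
      moreover have "\<forall>x\<in>A. (w, x) \<in> (insert (a, b) F)\<^sup>*"
        using less.prems(5) by (meson rtrancl_mono subsetD subset_insertI)
      ultimately show ?thesis
        using ab inv less.prems by (intro less.hyps[of "insert b A" "insert (a, b) F"]) auto
    qed
  qed
  from this[of "{w}" "{}"] show thesis using w oneR that by auto
qed

text \<open>
  Minimising the number of arcs leaving \<open>K\<close> ensures that a vertex of \<open>V1\<close> loses only few
  out-arcs to the red forest and keeps a blue one.
\<close>

lemma forest_without_siblings:
  assumes fin: "finite L" and reach: "V \<subseteq> L\<^sup>* `` R"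
  obtains E1 where "E1 \<subseteq> L" "V \<subseteq> E1\<^sup>* `` R" "\<And>a b. (a, b) \<in> E1 \<Longrightarrow> b \<notin> R"
    "\<And>x b c. x \<in> K \<Longrightarrow> (x, b) \<in> E1 \<Longrightarrow> (x, c) \<in> E1 \<Longrightarrow> b \<noteq> c \<Longrightarrow> b \<notin> K \<Longrightarrow> (b, c) \<notin> L"
proof -
  let ?m = "\<lambda>G. card (G \<inter> K \<times> UNIV)"
  define ok where "ok G \<longleftrightarrow> G \<subseteq> L \<and> V \<subseteq> G\<^sup>* `` R" for G
  define G where "G = arg_min ?m ok"
  have "ok L" using reach unfolding ok_def by auto
  then have G: "ok G" and min: "\<And>H. ok H \<Longrightarrow> ?m G \<le> ?m H"
    unfolding G_def by (auto intro: arg_min_natI arg_min_nat_le)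
  obtain P f where P: "P \<subseteq> G" "single_valued (P\<inverse>)" "\<And>a b. (a, b) \<in> P \<Longrightarrow> (f a :: nat) < f b"
    "\<And>a b. (a, b) \<in> P \<Longrightarrow> b \<notin> R" "G\<^sup>* `` R \<subseteq> P\<^sup>* `` R"
    using out_forest[of G R] by metis
  have PV: "V \<subseteq> P\<^sup>* `` R" "P \<subseteq> L" using P(1,5) G unfolding ok_def by auto
  have finP: "finite P" using PV(2) fin finite_subset by auto
  have "(b, c) \<notin> L" if x: "x \<in> K" "(x, b) \<in> P" "(x, c) \<in> P" "b \<noteq> c" "b \<notin> K" for x b c
  proof
    assume bc: "(b, c) \<in> L"
    \<comment> \<open>In \<open>H\<close> the vertex \<open>c\<close> is reached through its former
      sibling \<open>b\<close>. This saves an arc leaving \<open>K\<close> because \<open>b\<close>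
      is not in \<open>K\<close>, and \<open>x\<close>, which precedes \<open>c\<close> with respect
      to \<open>f\<close>, stays reached.\<close>
    define H where "H = insert (b, c) (P - {(x, c)})"
    have "y \<in> P\<^sup>* `` R \<Longrightarrow> y \<in> H\<^sup>* `` R" for y
    proof (induction "f y" arbitrary: y rule: less_induct)
      case less
      show ?case
      proof (cases "y \<in> R")
        case False
        then obtain a where a: "(a, y) \<in> P" "a \<in> P\<^sup>* `` R" using less.prems by (auto elim: rtranclE)
        then have aH: "a \<in> H\<^sup>* `` R" using less.hyps P(3) by auto
        show ?thesis
        proof (cases "(a, y) = (x, c)")
          case True
          then have "(x, b) \<in> H" "(b, c) \<in> H" using x unfolding H_def by auto
          then show ?thesis using aH True by (auto intro: rtrancl_into_rtrancl)
        next
          case False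
          then have "(a, y) \<in> H" using a unfolding H_def by auto
          then show ?thesis using aH by (auto intro: rtrancl_into_rtrancl)
        qed
      qed auto
    qed
    then have "V \<subseteq> H\<^sup>* `` R" using PV(1) by blast
    then have "ok H" using PV(2) bc unfolding ok_def H_def by blast
    moreover have "?m H < ?m P"
    proof (rule psubset_card_mono)
      show "H \<inter> K \<times> UNIV \<subset> P \<inter> K \<times> UNIV" using x unfolding H_def by auto
    qed (use finP in auto)
    moreover have "?m P \<le> ?m G" using P(1) G fin unfolding ok_def
      by (intro card_mono) (auto intro: finite_subset)
    ultimately show False using min[of H] by auto
  qed
  then show thesis using that[of P] PV P by blast
qed

section \<open>Red and blue arcs of a split digraph\<close>

lemma subset_singleton_if_card_le:
  assumes "finite A" "card A \<le> Suc 0"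
  obtains e where "A \<subseteq> {e}"
proof (cases "A = {}")
  case True then show ?thesis using that[of undefined] by simp
next
  case False
  then obtain e where "e \<in> A" by auto
  moreover have "\<forall>a\<in>A. \<forall>b\<in>A. a = b" using assms(2) unfolding card_le_Suc0_iff_eq[OF assms(1)] .
  ultimately show ?thesis using that[of e] by auto
qed

definition arc_disjoint_reach :: "'a set \<Rightarrow> 'a rel \<Rightarrow> 'a \<Rightarrow> 'a \<Rightarrow> bool" where
  "arc_disjoint_reach V E u v \<longleftrightarrow> (\<exists>Red\<subseteq>E. (\<forall>x\<in>V. (u, x) \<in> Red\<^sup>*) \<and> (\<forall>x\<in>V. (x, v) \<in> (E - Red)\<^sup>*))"

lemma arc_disjoint_reachI:
  assumes "Red \<subseteq> E" "\<And>x. x \<in> V \<Longrightarrow> (u, x) \<in> Red\<^sup>*" "\<And>x. x \<in> V \<Longrightarrow> (x, v) \<in> (E - Red)\<^sup>*"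
  shows "arc_disjoint_reach V E u v"
  using assms unfolding arc_disjoint_reach_def by blast

lemma arc_disjoint_reach_converse:
  assumes "arc_disjoint_reach V (E\<inverse>) v u"
  shows "arc_disjoint_reach V E u v"
proof -
  obtain Red where R: "Red \<subseteq> E\<inverse>" "\<forall>x\<in>V. (v, x) \<in> Red\<^sup>*" "\<forall>x\<in>V. (x, u) \<in> (E\<inverse> - Red)\<^sup>*"
    using assms unfolding arc_disjoint_reach_def by blast
  have "E - (E - Red\<inverse>) = Red\<inverse>" "E - Red\<inverse> = (E\<inverse> - Red)\<inverse>" using R(1) by auto
  then have "(u, x) \<in> (E - Red\<inverse>)\<^sup>*" "(x, v) \<in> (E - (E - Red\<inverse>))\<^sup>*" if "x \<in> V" for x
    using R(2,3) that by (metis converseI rtrancl_converse)+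
  then show ?thesis by (intro arc_disjoint_reachI[of "E - Red\<inverse>"]) auto
qed

text \<open>The cut form of 2-arc-strength, to which submodularity applies.\<close>

definition two_arc_strong :: "'a set \<Rightarrow> 'a rel \<Rightarrow> bool" where
  "two_arc_strong V E \<longleftrightarrow> (\<forall>X\<subseteq>V. X \<noteq> {} \<longrightarrow> X \<noteq> V \<longrightarrow> 2 \<le> card (entering E X))"

text \<open>Only out-degrees are bounded here: for two roots in \<open>V1\<close> an arc into
  \<open>v\<close> gets deleted, which may lower the in-degree of \<open>v\<close>, and the results
  of this locale must still apply.\<close>

locale split_relation =
  fixes V1 V2 :: "'a set" and E :: "'a rel"
  assumes finite_verts: "finite (V1 \<union> V2)" and disj: "V1 \<inter> V2 = {}"
    and arcs_verts: "E \<subseteq> (V1 \<union> V2) \<times> (V1 \<union> V2)"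
    and irr: "(x, x) \<notin> E"
    and indep: "x \<in> V1 \<Longrightarrow> y \<in> V1 \<Longrightarrow> (x, y) \<notin> E"
    and semi: "x \<in> V2 \<Longrightarrow> y \<in> V2 \<Longrightarrow> x \<noteq> y \<Longrightarrow> (x, y) \<in> E \<or> (y, x) \<in> E"
    and two_strong: "two_arc_strong (V1 \<union> V2) E"
    and outdeg: "x \<in> V1 \<Longrightarrow> 3 \<le> card (E `` {x})"
begin

definition V :: "'a set" where
  "V = V1 \<union> V2"

lemma fin: "finite V" and EV: "E \<subseteq> V \<times> V" and two: "two_arc_strong V E"
  using finite_verts arcs_verts two_strong unfolding V_def by auto

lemma finE: "finite E"
  using fin EV finite_subset by blast

lemma finite_out: "finite (E `` A)"
  using finE by (rule finite_Image)

lemma two_cut: "X \<subseteq> V \<Longrightarrow> X \<noteq> {} \<Longrightarrow> x \<in> V \<Longrightarrow> x \<notin> X \<Longrightarrow> 2 \<le> card (entering E X)"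
  using two unfolding two_arc_strong_def by auto

lemma V2_of_V1: "x \<in> V1 \<Longrightarrow> (x, y) \<in> E \<Longrightarrow> y \<in> V2" "x \<in> V1 \<Longrightarrow> (y, x) \<in> E \<Longrightarrow> y \<in> V2"
  using EV indep unfolding V_def by blast+

lemma strong_without_two_arcs:
  assumes "x \<in> V" "y \<in> V"
  shows "(x, y) \<in> (E - {(a, b), (b, c)})\<^sup>*"
proof -
  have "V \<subseteq> (E - {(a, b), (b, c)})\<^sup>* `` {x}"
  proof (rule reachable_if_entering)
    fix X assume X: "X \<subseteq> V" "X \<noteq> {}" "X \<inter> {x} = {}"
    \<comment> \<open>Of the two deleted arcs only \<open>e\<close> can enter \<open>X\<close>,
      since they meet in \<open>b\<close>.\<close>
    define e where "e = (if b \<in> X then (a, b) else (b, c))"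
    have "entering E X - {e} \<subseteq> entering (E - {(a, b), (b, c)}) X" unfolding e_def by auto
    moreover have "2 \<le> card (entering E X)" using two_cut[OF X(1,2) assms(1)] X(3) by auto
    then have "entering E X - {e} \<noteq> {}"
      using card_mono[of "{e}" "entering E X"] by fastforce
    ultimately show "entering (E - {(a, b), (b, c)}) X \<noteq> {}" by auto
  qed (use EV in auto)
  then show ?thesis using assms(2) by auto
qed

text \<open>Vertices are added one at a time: the new vertex dominates the current root or takes its
  place.\<close>

lemma semicomplete_root:
  assumes "S \<subseteq> V2" "S \<noteq> {}"
  obtains w where "w \<in> S" "\<And>s. s \<in> S \<Longrightarrow> (s, w) \<in> (E \<inter> S \<times> S)\<^sup>*"
proof -
  have "finite S" using assms fin finite_subset unfolding V_def by blast
  then have "\<exists>w\<in>S. \<forall>s\<in>S. (s, w) \<in> (E \<inter> S \<times> S)\<^sup>*" using assms(2,1)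
  proof (induction S rule: finite_ne_induct)
    case (insert a S)
    then obtain w where w: "w \<in> S" "\<forall>s\<in>S. (s, w) \<in> (E \<inter> S \<times> S)\<^sup>*" by auto
    have mono: "(E \<inter> S \<times> S)\<^sup>* \<subseteq> (E \<inter> insert a S \<times> insert a S)\<^sup>*" by (rule rtrancl_mono) auto
    have "a \<noteq> w" using insert w by auto
    then consider "(a, w) \<in> E" | "(w, a) \<in> E" using semi[of a w] insert w by auto
    then show ?case
    proof cases
      case 1
      then have "(a, w) \<in> (E \<inter> insert a S \<times> insert a S)\<^sup>*" using w by auto
      then show ?thesis using w mono by blast
    next
      case 2
      then have "(w, a) \<in> E \<inter> insert a S \<times> insert a S" using w by auto
      then have "(s, a) \<in> (E \<inter> insert a S \<times> insert a S)\<^sup>*" if "s \<in> S" for s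
        using w(2) that mono by (meson rtrancl.rtrancl_into_rtrancl subsetD)
      then show ?thesis by auto
    qed
  qed auto
  then show thesis using that by blast
qed

text \<open>
  If the reserved red arcs \<open>Er\<close> lead from the root to all of \<open>R\<close>, a red forest rooted at \<open>R\<close> has no arc
  into \<open>R\<close>, and when \<open>v\<close> is in \<open>R\<close> its arcs into out-neighbours of \<open>v\<close> can be replaced by arcs from \<open>v\<close>.
  Hence the following arcs can be kept blue whatever the forest is.
\<close>

definition safe :: "'a rel \<Rightarrow> 'a set \<Rightarrow> 'a \<Rightarrow> 'a rel" where
  "safe Er R v = {(a, b) \<in> E - Er. a \<noteq> v \<and> (b \<in> R \<or> (v, b) \<in> E)}"

text \<open>\<open>arc_disjoint_tree\<close> gives a tree \<open>F\<close> from \<open>w\<close>,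
  containing a path to \<open>v\<close>, and a disjoint forest rooted at \<open>R\<close>. Safe arcs
  bring each vertex of \<open>V2\<close> to \<open>w\<close> or \<open>v\<close>, and a vertex of
  \<open>V1\<close> only needs one blue arc into \<open>V2\<close>.\<close>

lemma good_if_blue_arcs:
  assumes v: "v \<in> V2" "v \<in> R" and R: "R \<subseteq> V" and Er: "Er \<subseteq> E \<inter> R \<times> R"
    and u: "R \<subseteq> Er\<^sup>* `` {u}"
    and w: "w \<in> V" "\<And>x. x \<in> V \<Longrightarrow> (w, x) \<in> (E - Er)\<^sup>*"
    and deg: "\<And>x. x \<in> V1 \<Longrightarrow> 2 \<le> card (E `` {x} - Er `` {x})"
    and blue: "\<And>z. z \<in> V2 \<Longrightarrow> (z, w) \<in> (safe Er R v)\<^sup>* \<or> (z, v) \<in> (safe Er R v)\<^sup>*"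
  shows "arc_disjoint_reach V E u v"
proof -
  let ?D = "E - Er"
  let ?B = "safe Er R v"
  have vV: "v \<in> V" using v unfolding V_def by auto
  have same: "entering ?D X = entering E X" if "X \<inter> R = {}" for X using that Er by auto
  have c2: "2 \<le> card (entering E X)" if "X \<subseteq> V" "X \<noteq> {}" "X \<inter> R = {}" for X
    using that two_cut[OF that(1,2) vV] v by auto
  obtain F where F: "F \<subseteq> ?D" "\<And>x. x \<in> V \<Longrightarrow> (w, x) \<in> F\<^sup>*" "V \<subseteq> (?D - F)\<^sup>* `` R"
  proof (rule arc_disjoint_tree[of V ?D w R])
    show "entering ?D X \<noteq> {}" if "X \<subseteq> V" "X \<noteq> {}" "w \<notin> X" for X
      using that entering_if_reachable[of w _ ?D X] w(2) by blast
    show "entering ?D X \<noteq> {}" if "X \<subseteq> V" "X \<noteq> {}" "X \<inter> R = {}" for X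
    proof -
      have "card (entering ?D X) \<noteq> 0" using c2[OF that] same[OF that(3)] by simp
      then show ?thesis by (metis card.empty)
    qed
    show "2 \<le> card (entering ?D X)" if "X \<subseteq> V" "X \<noteq> {}" "X \<inter> R = {}" for X
      using c2[OF that] same[OF that(3)] by simp
  qed (use fin EV w in auto)
  \<comment> \<open>A blue walk along \<open>F\<close> needs only the arcs whose tail cannot step
    directly to \<open>v\<close>. Releasing the others to the forest makes the sibling condition
    stronger.\<close>
  define F' where "F' = {(a, b) \<in> F. (a, v) \<notin> ?D \<and> a \<noteq> v}"
  have "V \<subseteq> (?D - F')\<^sup>* `` R"
    using F(3) rtrancl_mono[of "?D - F" "?D - F'"] unfolding F'_def by blast
  then obtain E1 where E1: "E1 \<subseteq> ?D - F'" "V \<subseteq> E1\<^sup>* `` R" "\<And>a b. (a, b) \<in> E1 \<Longrightarrow> b \<notin> R"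
    and sib: "\<And>x b c. x \<in> V1 \<Longrightarrow> (x, b) \<in> E1 \<Longrightarrow> (x, c) \<in> E1 \<Longrightarrow> b \<noteq> c \<Longrightarrow> b \<notin> V1 \<Longrightarrow> (b, c) \<notin> ?D - F'"
    using forest_without_siblings[of "?D - F'" V R V1] finE by auto
  define Red where "Red = Er \<union> E \<inter> {v} \<times> UNIV \<union> {(a, b) \<in> E1. (v, b) \<notin> E}"
  have BR: "?B \<subseteq> E - Red" using E1(3) unfolding Red_def safe_def by auto
  have red: "(u, x) \<in> Red\<^sup>*" if xV: "x \<in> V" for x
  proof -
    have uR: "(u, r) \<in> Red\<^sup>*" if "r \<in> R" for r
      using u that rtrancl_mono[of Er Red] unfolding Red_def by blast
    obtain r where r: "r \<in> R" "(r, x) \<in> E1\<^sup>*" using E1(2) xV by blast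
    from r(2) show ?thesis
    proof (induction rule: rtrancl_induct)
      case base
      then show ?case using uR r(1) by auto
    next
      case (step y z)
      have "(y, z) \<in> Red \<or> (v, z) \<in> Red" using step(2) unfolding Red_def by auto
      then show ?case using step uR v by (meson rtrancl.rtrancl_into_rtrancl)
    qed
  qed
  have wv: "(z, v) \<in> (E - Red)\<^sup>*" if "(z, v) \<in> F\<^sup>*" for z
    using that
  proof (induction rule: converse_rtrancl_induct)
    case (step y z)
    consider "y = v" | "y \<noteq> v" "(y, v) \<in> ?D" | "y \<noteq> v" "(y, v) \<notin> ?D" by auto
    then show ?case
    proof cases
      case 2
      then have "(y, v) \<in> ?B" using v unfolding safe_def by auto
      then show ?thesis using BR by auto
    next
      case 3
      then have "(y, z) \<in> F'" using step unfolding F'_def by auto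
      then have "(y, z) \<in> E - Red" using 3 step(1) F(1) E1(1) unfolding Red_def by auto
      then show ?thesis using step(3) by (rule converse_rtrancl_into_rtrancl)
    qed auto
  qed auto
  have blueV2: "(z, v) \<in> (E - Red)\<^sup>*" if "z \<in> V2" for z
    using blue[OF that] rtrancl_mono[OF BR] wv[OF F(2)[OF vV]] by (meson rtrancl_trans subsetD)
  have blueV1: "(x, v) \<in> (E - Red)\<^sup>*" if x: "x \<in> V1" for x
  proof -
    \<comment> \<open>Otherwise \<open>x\<close> has two forest children \<open>b\<close> and
      \<open>c\<close> that are not dominated by \<open>v\<close>. Both dominate \<open>v\<close>,
      so an arc joining them lies outside \<open>F'\<close>, which the sibling condition
      forbids.\<close>
    have "\<exists>b. (x, b) \<in> E - Red"
    proof (rule ccontr)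
      assume no: "\<nexists>b. (x, b) \<in> E - Red"
      have xv: "x \<noteq> v" using x v disj by auto
      have "\<not> card (E `` {x} - Er `` {x}) \<le> Suc 0" using deg[OF x] by simp
      then obtain b c where bc: "b \<in> E `` {x} - Er `` {x}" "c \<in> E `` {x} - Er `` {x}" "b \<noteq> c"
        using card_le_Suc0_iff_eq[of "E `` {x} - Er `` {x}"] finite_out by auto
      then have E1bc: "(x, b) \<in> E1" "(x, c) \<in> E1" and nv: "(v, b) \<notin> E" "(v, c) \<notin> E"
        using no xv unfolding Red_def by auto
      have V2: "b \<in> V2" "c \<in> V2" using V2_of_V1 x bc by auto
      have nR: "b \<notin> R" "c \<notin> R" using E1(3) E1bc by auto
      have D: "(b, v) \<in> ?D" "(c, v) \<in> ?D" using nv nR V2 v Er semi[of _ v] by auto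
      have "(b, c) \<in> ?D - F' \<or> (c, b) \<in> ?D - F'"
        using semi[OF V2 bc(3)] Er nR D unfolding F'_def by auto
      then show False using sib[OF x E1bc(1,2) bc(3)] sib[OF x E1bc(2,1)] V2 bc(3) disj by auto
    qed
    then obtain b where b: "(x, b) \<in> E - Red" by auto
    then have "b \<in> V2" using V2_of_V1(1)[OF x] by auto
    then show ?thesis using blueV2 converse_rtrancl_into_rtrancl[OF b] by auto
  qed
  show ?thesis
    by (rule arc_disjoint_reachI[of Red]) (use red blueV1 blueV2 Er E1(1) in \<open>auto simp: V_def Red_def\<close>)
qed

lemma two_le_out_Diff:
  assumes "x \<in> V1" "B `` {x} \<subseteq> {a}"
  shows "2 \<le> card (E `` {x} - B `` {x})"
proof -
  have "card (E `` {x}) - card {a} \<le> card (E `` {x} - {a})" by (rule diff_card_le_card_Diff) simp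
  also have "\<dots> \<le> card (E `` {x} - B `` {x})" using assms finite_out by (intro card_mono) auto
  finally show ?thesis using outdeg[OF assms(1)] by simp
qed

text \<open>
  The vertex \<open>p\<close> of \<open>V2\<close> acts as the root in place of \<open>u\<close>; the arc from \<open>u\<close> to \<open>p\<close>, if any, is reserved
  for the red arcs. Below, the set \<open>{(u, p)} - Id\<close> is empty when \<open>u = p\<close>.
\<close>

definition root_via :: "'a \<Rightarrow> 'a \<Rightarrow> bool" where
  "root_via u p \<longleftrightarrow> p \<in> V2 \<and> (u = p \<or> u \<in> V1 \<and> (u, p) \<in> E)"

section \<open>Reserved red paths from the first root to the second\<close>

lemma strong_mono:
  assumes "(x, y) \<in> (E - A)\<^sup>*" "B \<subseteq> A" shows "(x, y) \<in> (E - B)\<^sup>*"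
  using assms rtrancl_mono[of "E - A" "E - B"] by blast

text \<open>Vertices of \<open>V2 - {v}\<close> not dominating \<open>v\<close> are dominated by
  \<open>v\<close>, so the arcs among them are safe and lead to a common \<open>w\<close>. All
  others step directly to \<open>v\<close>.\<close>

lemma good_at_target:
  assumes v: "root_via u v"
  shows "arc_disjoint_reach V E u v"
proof -
  have vV: "v \<in> V2" and uV: "u \<in> V" using v unfolding root_via_def V_def by auto
  define Er where "Er = {(u, v)} - Id"
  define S where "S = {s \<in> V2. s \<noteq> v \<and> (s, v) \<notin> E}"
  obtain w where w: "w \<in> V2" "\<And>s. s \<in> S \<Longrightarrow> (s, w) \<in> (E \<inter> S \<times> S)\<^sup>*"
  proof (cases "S = {}")
    case True then show ?thesis using that[of v] vV by auto
  next
    case False then show ?thesis using semicomplete_root[of S] that unfolding S_def by auto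
  qed
  have SB: "E \<inter> S \<times> S \<subseteq> safe Er {u, v} v"
    using semi vV unfolding safe_def S_def Er_def by auto
  show ?thesis
  proof (rule good_if_blue_arcs[of v "{u, v}" Er u w])
    show "Er \<subseteq> E \<inter> {u, v} \<times> {u, v}" using v unfolding Er_def root_via_def by auto
    show "{u, v} \<subseteq> Er\<^sup>* `` {u}" unfolding Er_def by (cases "u = v") auto
    show "(w, x) \<in> (E - Er)\<^sup>*" if "x \<in> V" for x
      \<comment> \<open>The loop \<open>(v, v)\<close> fills the place of the second deleted
        arc.\<close>
      by (rule strong_mono[OF strong_without_two_arcs[of w x u v v]]) (use that w in \<open>auto simp: Er_def V_def\<close>)
    show "2 \<le> card (E `` {x} - Er `` {x})" if "x \<in> V1" for x
      by (rule two_le_out_Diff[OF that, of _ v]) (auto simp: Er_def)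
    fix z assume z: "z \<in> V2"
    consider "z = v" | "z \<in> S" | "z \<noteq> v" "(z, v) \<in> E" using z unfolding S_def by auto
    then show "(z, w) \<in> (safe Er {u, v} v)\<^sup>* \<or> (z, v) \<in> (safe Er {u, v} v)\<^sup>*"
    proof cases
      case 2
      then show ?thesis using w(2) rtrancl_mono[OF SB] by auto
    next
      case 3
      then have "(z, v) \<in> safe Er {u, v} v" using v z disj unfolding safe_def Er_def root_via_def by auto
      then show ?thesis by auto
    qed auto
  qed (use vV uV w in \<open>auto simp: V_def\<close>)
qed

text \<open>Both \<open>p\<close> and \<open>v\<close> dominate \<open>S\<close>. As the arc from
  \<open>p\<close> to \<open>v\<close> is reserved for red, blue walks arriving at \<open>p\<close>
  continue to \<open>w\<close> in \<open>S\<close>; if \<open>S\<close> is empty, \<open>p\<close>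
  itself serves as \<open>w\<close>.\<close>

lemma good_if_arc:
  assumes p: "root_via u p" and v: "v \<in> V2" and pv: "(p, v) \<in> E"
  shows "arc_disjoint_reach V E u v"
proof -
  have pV: "p \<in> V2" and uV: "u \<in> V" and ne: "p \<noteq> v" using p pv irr unfolding root_via_def V_def by auto
  define Er where "Er = {(u, p), (p, v)} - Id"
  define S where "S = {s \<in> V2 - {p, v}. (s, p) \<notin> E \<and> (s, v) \<notin> E}"
  let ?R = "{u, p, v}"
  let ?B = "safe Er ?R v"
  obtain w where w: "w \<in> V2" "(p, w) \<in> ?B\<^sup>*" "\<And>s. s \<in> S \<Longrightarrow> (s, w) \<in> (E \<inter> S \<times> S)\<^sup>*"
  proof (cases "S = {}")
    case True then show ?thesis using that[of p] pV by auto
  next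
    case False
    obtain w where w: "w \<in> S" "\<And>s. s \<in> S \<Longrightarrow> (s, w) \<in> (E \<inter> S \<times> S)\<^sup>*"
      using semicomplete_root[of S] False unfolding S_def by auto
    have "(p, w) \<in> ?B" using w(1) pV v ne semi[of p w] semi[of v w] p disj
      unfolding safe_def S_def Er_def root_via_def by auto
    then show ?thesis using that[of w] w unfolding S_def by auto
  qed
  have SB: "E \<inter> S \<times> S \<subseteq> ?B"
    using semi v unfolding safe_def S_def Er_def by auto
  show ?thesis
  proof (rule good_if_blue_arcs[of v ?R Er u w])
    show "Er \<subseteq> E \<inter> ?R \<times> ?R" using p pv unfolding Er_def root_via_def by auto
    have "(u, p) \<in> Er\<^sup>*" unfolding Er_def by (cases "u = p") auto
    moreover have "(p, v) \<in> Er" using ne unfolding Er_def by auto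
    ultimately show "?R \<subseteq> Er\<^sup>* `` {u}" by (auto intro: rtrancl_into_rtrancl)
    show "(w, x) \<in> (E - Er)\<^sup>*" if "x \<in> V" for x
      by (rule strong_mono[OF strong_without_two_arcs[of w x u p v]]) (use that w in \<open>auto simp: Er_def V_def\<close>)
    show "2 \<le> card (E `` {x} - Er `` {x})" if "x \<in> V1" for x
      by (rule two_le_out_Diff[OF that, of _ p]) (use pV that disj in \<open>auto simp: Er_def\<close>)
    fix z assume z: "z \<in> V2"
    consider "z = v" | "z = p" | "z \<in> S" | "z \<noteq> v" "z \<noteq> p" "(z, v) \<in> E" | "z \<noteq> v" "z \<noteq> p" "(z, p) \<in> E"
      using z unfolding S_def by auto
    then show "(z, w) \<in> ?B\<^sup>* \<or> (z, v) \<in> ?B\<^sup>*"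
    proof cases
      case 3
      then show ?thesis using w(3) rtrancl_mono[OF SB] by auto
    next
      case 4
      then have "(z, v) \<in> ?B" using p z disj unfolding safe_def Er_def root_via_def by auto
      then show ?thesis by auto
    next
      case 5
      then have "(z, p) \<in> ?B" using p z disj unfolding safe_def Er_def root_via_def by auto
      then show ?thesis using w(2) by auto
    qed (use w in auto)
  qed (use v uV pV w in \<open>auto simp: V_def\<close>)
qed

text \<open>
  Deleting two consecutive arcs from a 2-arc-strong digraph leaves it strong because no cut contains
  both. When \<open>u \<noteq> p\<close> a third arc is deleted, and \<open>p'\<close> provides a replacement for it.
\<close>

lemma good_if_two_path:
  assumes p: "root_via u p" and v: "v \<in> V2" and y: "y \<in> V2" "(p, y) \<in> E" "(y, v) \<in> E" and ne: "p \<noteq> v"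
    and p2: "u = p \<or> (\<exists>p'. (u, p') \<in> E \<and> (p', p) \<in> E \<and> p' \<noteq> y \<and> p' \<noteq> v)"
    and S: "S = {s \<in> V2 - {p, y, v}. (s, p) \<notin> E \<and> (s, v) \<notin> E}"
    and B: "B = safe ({(u, p), (p, y), (y, v)} - Id) {u, p, y, v} v"
    and w: "w \<in> V2" "(p, w) \<in> B\<^sup>*" "(y, w) \<in> B\<^sup>*" "\<And>s. s \<in> S \<Longrightarrow> (s, w) \<in> B\<^sup>*"
  shows "arc_disjoint_reach V E u v"
proof -
  have pV: "p \<in> V2" and uV: "u \<in> V" and ne': "p \<noteq> y" "y \<noteq> v" "u \<noteq> y"
    using p y irr disj unfolding root_via_def V_def by auto
  define Er where "Er = {(u, p), (p, y), (y, v)} - Id"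
  let ?R = "{u, p, y, v}"
  show ?thesis
  proof (rule good_if_blue_arcs[of v ?R Er u w])
    show "Er \<subseteq> E \<inter> ?R \<times> ?R" using p y unfolding Er_def root_via_def by auto
    have "(u, p) \<in> Er\<^sup>*" unfolding Er_def by (cases "u = p") auto
    moreover have "(p, y) \<in> Er" "(y, v) \<in> Er" using ne' unfolding Er_def by auto
    ultimately have "(u, p) \<in> Er\<^sup>*" "(u, y) \<in> Er\<^sup>*" "(u, v) \<in> Er\<^sup>*" by (meson rtrancl_into_rtrancl)+
    then show "?R \<subseteq> Er\<^sup>* `` {u}" by auto
    show "(w, x) \<in> (E - Er)\<^sup>*" if "x \<in> V" for x
    proof -
      have "(w, x) \<in> (E - {(p, y), (y, v)})\<^sup>*" using strong_without_two_arcs that w(1) unfolding V_def by auto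
      then show ?thesis
      proof (induction rule: rtrancl_induct)
        case (step a b)
        have "(a, b) \<in> (E - Er)\<^sup>*"
        proof (cases "(a, b) = (u, p) \<and> u \<noteq> p")
          case True
          then obtain p' where p': "(u, p') \<in> E" "(p', p) \<in> E" "p' \<noteq> y" "p' \<noteq> v" using p2 by auto
          have "p' \<noteq> p" "p' \<noteq> u" using p' irr by auto
          then have "(u, p') \<in> E - Er" "(p', p) \<in> E - Er" using p' ne' True pV v y uV p disj
            unfolding Er_def root_via_def by auto
          then show ?thesis using True by (metis Pair_inject converse_rtrancl_into_rtrancl r_into_rtrancl)
        qed (use step(2) in \<open>auto simp: Er_def\<close>)
        then show ?case using step(3) by auto
      qed auto
    qed
    show "2 \<le> card (E `` {x} - Er `` {x})" if "x \<in> V1" for x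
      by (rule two_le_out_Diff[OF that, of _ p]) (use pV y that disj in \<open>auto simp: Er_def\<close>)
    fix z assume z: "z \<in> V2"
    have B': "B = safe Er ?R v" unfolding B Er_def ..
    consider "z = v" | "z = p" | "z = y" | "z \<in> S" | "z \<notin> {p, y, v}" "(z, v) \<in> E" | "z \<notin> {p, y, v}" "(z, p) \<in> E"
      using z unfolding S by auto
    then show "(z, w) \<in> (safe Er ?R v)\<^sup>* \<or> (z, v) \<in> (safe Er ?R v)\<^sup>*"
      unfolding B'[symmetric]
    proof cases
      case 5
      then have "(z, v) \<in> B" using p z disj unfolding B safe_def root_via_def by auto
      then show "(z, w) \<in> B\<^sup>* \<or> (z, v) \<in> B\<^sup>*" by auto
    next
      case 6
      then have "(z, p) \<in> B" using p z disj unfolding B safe_def root_via_def by auto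
      then show "(z, w) \<in> B\<^sup>* \<or> (z, v) \<in> B\<^sup>*" using w(2) by auto
    qed (use w in auto)
  qed (use v uV pV y w in \<open>auto simp: V_def\<close>)
qed

text \<open>The nonempty set \<open>S\<close> is dominated by \<open>p\<close>. If \<open>y\<close>
  dominates a vertex of \<open>S\<close>, a vertex reached from all of \<open>S\<close> serves as
  \<open>w\<close>; otherwise all of \<open>S\<close> dominates \<open>y\<close>, and
  \<open>y\<close> serves as \<open>w\<close>.\<close>

lemma good_if_two_path_sink:
  assumes p: "root_via u p" and v: "v \<in> V2" and y: "y \<in> V2" "(p, y) \<in> E" "(y, v) \<in> E" and ne: "p \<noteq> v"
    and p2: "u = p \<or> (\<exists>p'. (u, p') \<in> E \<and> (p', p) \<in> E \<and> p' \<noteq> y \<and> p' \<noteq> v)"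
    and s: "s \<in> V2 - {p, y, v}" "(s, p) \<notin> E" "(s, v) \<notin> E"
  shows "arc_disjoint_reach V E u v"
proof -
  define S where "S = {s \<in> V2 - {p, y, v}. (s, p) \<notin> E \<and> (s, v) \<notin> E}"
  define B where "B = safe ({(u, p), (p, y), (y, v)} - Id) {u, p, y, v} v"
  have pV: "p \<in> V2" using p unfolding root_via_def by auto
  have un: "u \<notin> V2 - {p}" using p disj unfolding root_via_def by auto
  have sS: "s \<in> S" using s unfolding S_def by auto
  have S: "(p, s') \<in> E" "(v, s') \<in> E" "s' \<in> V2" "s' \<noteq> p" "s' \<noteq> y" "s' \<noteq> v" if "s' \<in> S" for s'
    using that semi[of p s'] semi[of v s'] pV v unfolding S_def by auto
  obtain w where w: "w \<in> S" "\<And>s. s \<in> S \<Longrightarrow> (s, w) \<in> (E \<inter> S \<times> S)\<^sup>*"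
    using semicomplete_root[of S] sS unfolding S_def by auto
  have nS: "p \<notin> S" "y \<notin> S" "v \<notin> S" unfolding S_def by auto
  have "E \<inter> S \<times> S \<subseteq> B" using S nS un unfolding B_def safe_def by auto
  then have SB: "(s', w) \<in> B\<^sup>*" if "s' \<in> S" for s' using w(2)[OF that] rtrancl_mono by blast
  have pS: "(p, s') \<in> B" if "s' \<in> S" for s' using S[OF that] ne un unfolding B_def safe_def by auto
  show ?thesis
  proof (cases "\<exists>s'\<in>S. (y, s') \<in> E")
    case True
    then obtain s' where s': "s' \<in> S" "(y, s') \<in> E" by auto
    then have "(y, s') \<in> B" using S[OF s'(1)] y irr un unfolding B_def safe_def by auto
    then have "(y, w) \<in> B\<^sup>*" using SB[OF s'(1)] by auto
    moreover have "w \<in> V2" using w(1) S by auto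
    moreover have "(p, w) \<in> B\<^sup>*" using pS w(1) by auto
    ultimately show ?thesis using good_if_two_path[OF p v y ne p2 S_def B_def] SB by blast
  next
    case False
    then have "(s', y) \<in> B" if "s' \<in> S" for s'
      using S[OF that] semi[of s' y] y that un unfolding B_def safe_def by auto
    then have sy: "(s', y) \<in> B\<^sup>*" if "s' \<in> S" for s' using that by auto
    then have "(p, y) \<in> B\<^sup>*" using pS[OF sS] sS by (meson converse_rtrancl_into_rtrancl)
    then show ?thesis using good_if_two_path[OF p v y ne p2 S_def B_def y(1)] sy by auto
  qed
qed

section \<open>No vertex lying only between the roots\<close>

text \<open>
  Let \<open>S\<close> be the set of vertices not dominating \<open>p\<close>. All of \<open>S\<close> is dominated by both \<open>p\<close> and \<open>v\<close>, so
  \<open>v\<close> provides the red arcs into \<open>S\<close> and the arcs inside \<open>S\<close> can stay blue, provided a red path to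
  \<open>v\<close> uses none of them. Therefore the vertices of \<open>S\<close> with an in-neighbour in \<open>S\<close> are taken as
  additional roots of the red forest; if the red path to \<open>v\<close> starts in such a root \<open>a0\<close>, the arc from
  \<open>p\<close> to \<open>a0\<close> becomes red and the blue walks pass from \<open>p\<close> to \<open>a0\<close> via an in-neighbour of \<open>a0\<close> in \<open>S\<close>.
\<close>

lemma good_if_no_bypass:
  assumes p: "root_via u p" and v: "v \<in> V2" "p \<noteq> v" "(p, v) \<notin> E"
    and nb: "\<And>z. z \<in> V2 - {p, v} \<Longrightarrow> (z, p) \<in> E \<or> (v, z) \<in> E"
    and out: "u = p \<or> E `` {u} \<subseteq> E `` {v}"
  shows "arc_disjoint_reach V E u v"
proof -
  have pV: "p \<in> V2" "p \<in> V" and uV: "u \<in> V" and vV: "v \<in> V" using p v unfolding root_via_def V_def by auto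
  have un: "u \<notin> V2 - {p}" using p disj unfolding root_via_def by auto
  define Eu where "Eu = {(u, p)} - Id"
  have Eu: "Eu \<subseteq> {(u, p)}" "Eu \<subseteq> E" using p unfolding Eu_def root_via_def by auto
  have Eu_up: "(u, p) \<in> Eu\<^sup>*" unfolding Eu_def by (cases "u = p") auto
  define S where "S = {s \<in> V2 - {p, v}. (s, p) \<notin> E}"
  have S: "(p, s) \<in> E" "(v, s) \<in> E" "s \<in> V2" "s \<noteq> p" "s \<noteq> v" "s \<noteq> u" if "s \<in> S" for s
    using that nb[of s] semi[of s p] pV un unfolding S_def by auto
  define Ss where "Ss = {s \<in> S. \<exists>s'\<in>S. (s', s) \<in> E}"
  obtain w where w: "w \<in> V2" "\<And>s. s \<in> S \<Longrightarrow> (s, w) \<in> (E \<inter> S \<times> S)\<^sup>*" "S = {} \<and> w = p \<or> S = {w} \<or> w \<in> Ss"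
  proof (cases "S = {}")
    case True then show ?thesis using that[of p] pV by auto
  next
    case False
    obtain w where w: "w \<in> S" "\<And>s. s \<in> S \<Longrightarrow> (s, w) \<in> (E \<inter> S \<times> S)\<^sup>*"
      using semicomplete_root[of S] False unfolding S_def by auto
    have "w \<in> Ss" if nw: "S \<noteq> {w}"
    proof -
      obtain s where "s \<in> S" "s \<noteq> w" using nw w(1) by auto
      then obtain s' where "(s', w) \<in> E \<inter> S \<times> S" using w(2)[of s] by (meson rtranclE)
      then show ?thesis unfolding Ss_def by auto
    qed
    then show ?thesis using that[of w] w S by auto
  qed
  have wV: "w \<in> V" using w unfolding V_def by auto
  \<comment> \<open>If \<open>S\<close> consists of \<open>w\<close> alone, then \<open>Ss\<close>
    is empty and does not protect the arc from \<open>p\<close> to \<open>w\<close>, so it is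
    withheld from the forest.\<close>
  define Es where "Es = (if S = {w} then {(p, w)} else {})"
  define D where "D = E - Eu - Es"
  define R where "R = {u, p} \<union> Ss"
  have RV: "R \<subseteq> V" using uV pV S unfolding R_def Ss_def V_def by auto
  have D: "E - {(u, p), (p, w)} \<subseteq> D" "D \<subseteq> E" using Eu unfolding D_def Es_def by auto
  have same: "entering D X = entering E X" if "X \<inter> R = {}" "w \<notin> X" for X
    using that Eu unfolding D_def Es_def R_def by auto
  have sub: "entering E X - {(p, w)} \<subseteq> entering D X" if "X \<inter> R = {}" for X
    using that Eu unfolding D_def Es_def R_def by auto
  have c2: "2 \<le> card (entering E X)" if "X \<subseteq> V" "X \<noteq> {}" "X \<inter> R = {}" for X
    using that two_cut[OF that(1,2) pV(2)] unfolding R_def by auto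
  obtain F where F: "F \<subseteq> D" "\<And>x. x \<in> V \<Longrightarrow> (w, x) \<in> F\<^sup>*" "V \<subseteq> (D - F)\<^sup>* `` R"
  proof (rule arc_disjoint_tree[of V D w R])
    show "entering D X \<noteq> {}" if X: "X \<subseteq> V" "X \<noteq> {}" "w \<notin> X" for X
    proof -
      obtain x where "x \<in> X" using X by auto
      then show ?thesis
        using entering_if_reachable[of w x "E - {(u, p), (p, w)}" X] strong_without_two_arcs[of w x u p w] wV X D(1) by blast
    qed
    show "entering D X \<noteq> {}" if "X \<subseteq> V" "X \<noteq> {}" "X \<inter> R = {}" for X
    proof
      assume "entering D X = {}"
      then have "entering E X \<subseteq> {(p, w)}" using sub[OF that(3)] by auto
      then have "card (entering E X) \<le> 1" using card_mono[of "{(p, w)}"] by fastforce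
      then show False using c2[OF that] by auto
    qed
    show "2 \<le> card (entering D X)" if "X \<subseteq> V" "X \<noteq> {}" "X \<inter> R = {}" "w \<notin> X" for X
      using c2[OF that(1-3)] same[OF that(3,4)] by simp
  qed (use fin EV wV D in auto)
  \<comment> \<open>Passing to a forest excludes that \<open>Q\<close> joins three vertices pairwise.\<close>
  obtain Q f where Q: "Q \<subseteq> F" "single_valued (Q\<inverse>)" "\<And>a b. (a, b) \<in> Q \<Longrightarrow> (f a :: nat) < f b"
    "F\<^sup>* `` {w} \<subseteq> Q\<^sup>* `` {w}"
    using out_forest[of F "{w}"] by metis
  have "V \<subseteq> (D - Q)\<^sup>* `` R"
    using F(3) rtrancl_mono[of "D - F" "D - Q"] Q(1) by blast
  then obtain E1 where E1: "E1 \<subseteq> D - Q" "V \<subseteq> E1\<^sup>* `` R" "\<And>a b. (a, b) \<in> E1 \<Longrightarrow> b \<notin> R"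
    and sib: "\<And>x b c. x \<in> V1 \<Longrightarrow> (x, b) \<in> E1 \<Longrightarrow> (x, c) \<in> E1 \<Longrightarrow> b \<noteq> c \<Longrightarrow> b \<notin> V1 \<Longrightarrow> (b, c) \<notin> D - Q"
    using forest_without_siblings[of "D - Q" V R V1] finE D(2) by (metis finite_Diff finite_subset)
  \<comment> \<open>Reversed, \<open>N\<close> consists of forest paths towards \<open>v\<close>
    with at most one out-arc at each vertex. This bounds the number of red out-arcs of
    \<open>u\<close>.\<close>
  obtain N g where N: "N \<subseteq> E1\<inverse>" "single_valued (N\<inverse>)" "\<And>a b. (a, b) \<in> N \<Longrightarrow> b \<in> (E1\<inverse>)\<^sup>* `` {v}"
    "(E1\<inverse>)\<^sup>* `` {v} \<subseteq> N\<^sup>* `` {v}"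
    using out_forest[of "E1\<inverse>" "{v}"] by metis
  define P1 where "P1 = N\<inverse>"
  have P1: "P1 \<subseteq> E1" "single_valued P1" "\<And>a b. (a, b) \<in> P1 \<Longrightarrow> (a, v) \<in> E1\<^sup>*"
    "\<And>x. (x, v) \<in> E1\<^sup>* \<Longrightarrow> (x, v) \<in> P1\<^sup>*"
    using N unfolding P1_def by (auto simp: rtrancl_converse)
  obtain a0 where a0: "a0 \<in> R" "(a0, v) \<in> E1\<^sup>*" using E1(2) vV by blast
  \<comment> \<open>If neither \<open>u\<close> nor \<open>p\<close> starts a forest path to
    \<open>v\<close>, such a path starts at some \<open>a0\<close> in \<open>Ss\<close>, and
    \<open>(p, a0)\<close> has to become red.\<close>
  define up where "up \<longleftrightarrow> (u, v) \<in> E1\<^sup>* \<or> (p, v) \<in> E1\<^sup>*"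
  define Ea where "Ea = (if up then {} else {(p, a0)})"
  have a0S: "a0 \<in> Ss" if "\<not> up" using a0 that unfolding up_def R_def by auto
  \<comment> \<open>Forest arcs into out-neighbours of \<open>v\<close> are replaced by arcs from
    \<open>v\<close>, except for those in \<open>P1\<close>, along which \<open>v\<close> itself is
    reached.\<close>
  define Red where "Red = Eu \<union> Ea \<union> P1 \<union> E \<inter> {v} \<times> UNIV \<union> {(a, b) \<in> E1. (v, b) \<notin> E}"
  have EaS: "a = p \<and> b = a0 \<and> a0 \<in> Ss \<and> a0 \<in> S \<and> \<not> up" if "(a, b) \<in> Ea" for a b
    using that a0S unfolding Ea_def Ss_def by (auto split: if_splits)
  have "Ea \<subseteq> E" using S(1) EaS by fast
  then have RedE: "Red \<subseteq> E" using Eu(2) E1(1) D(2) P1(1) unfolding Red_def by auto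
  have RedD: "(a, b) \<in> Eu \<or> (a, b) \<in> Ea \<or> a = v \<or> (a, b) \<in> P1 \<or> (a, b) \<in> E1 \<and> (v, b) \<notin> E"
    if "(a, b) \<in> Red" for a b using that unfolding Red_def by auto
  have mono: "(x, y) \<in> G\<^sup>* \<Longrightarrow> (x, y) \<in> Red\<^sup>*" if "G \<subseteq> Red" for G x y
    using rtrancl_mono[OF that] by auto
  have up_red: "(u, p) \<in> Red\<^sup>*" using mono[of Eu] Eu_up unfolding Red_def by auto
  have P1_red: "(x, y) \<in> P1\<^sup>* \<Longrightarrow> (x, y) \<in> Red\<^sup>*" for x y using mono[of P1] unfolding Red_def by auto
  have uv_red: "(u, v) \<in> Red\<^sup>*"
  proof (cases up)
    case True
    then show ?thesis using P1(4) P1_red up_red unfolding up_def by (meson rtrancl_trans)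
  next
    case False
    then have "(p, a0) \<in> Red" unfolding Red_def Ea_def by auto
    then show ?thesis using up_red P1_red[OF P1(4)[OF a0(2)]] by (meson rtrancl_into_rtrancl rtrancl_trans)
  qed
  have red: "(u, x) \<in> Red\<^sup>*" if xV: "x \<in> V" for x
  proof -
    have v_red: "(u, z) \<in> Red\<^sup>*" if "(v, z) \<in> E" for z
      using uv_red that unfolding Red_def by (auto intro: rtrancl_into_rtrancl)
    obtain r where r: "r \<in> R" "(r, x) \<in> E1\<^sup>*" using E1(2) xV by blast
    from r(2) show ?thesis
    proof (induction rule: rtrancl_induct)
      case base
      then show ?case using up_red v_red r(1) S unfolding R_def Ss_def by auto
    next
      case (step y z)
      have "(y, z) \<in> Red \<or> (v, z) \<in> E" using step(2) unfolding Red_def by auto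
      then show ?case using step v_red by (auto intro: rtrancl_into_rtrancl)
    qed
  qed
  let ?Bl = "E - Red"
  have E1R: "b \<notin> R" if "(a, b) \<in> P1 \<or> (a, b) \<in> E1" for a b using that P1(1) E1(3) by auto
  have to_p: "(z, p) \<in> ?Bl" if z: "z \<in> V2 - S - {p, v}" for z
  proof -
    have "(z, p) \<in> E" using z unfolding S_def by auto
    moreover have "(z, p) \<notin> Red"
    proof
      assume "(z, p) \<in> Red"
      then show False using RedD[of z p] z un Eu E1R[of z p] EaS[of z p] unfolding R_def by auto
    qed
    ultimately show ?thesis by auto
  qed
  have SS: "E \<inter> S \<times> S \<subseteq> ?Bl"
  proof
    fix e assume "e \<in> E \<inter> S \<times> S"
    then obtain s t where e: "e = (s, t)" "(s, t) \<in> E" "s \<in> S" "t \<in> S" by auto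
    then have "t \<in> R" unfolding R_def Ss_def by auto
    then have "(s, t) \<notin> Red" using RedD[of s t] S[OF e(3)] Eu E1R[of s t] EaS[of s t] by auto
    then show "e \<in> ?Bl" using e by auto
  qed
  have Sw: "(s, w) \<in> ?Bl\<^sup>*" if "s \<in> S" for s using w(2)[OF that] rtrancl_mono[OF SS] by auto
  have detour: "\<exists>s'\<in>S. (p, s') \<in> ?Bl \<and> (s', a0) \<in> ?Bl" if nup: "\<not> up"
  proof -
    obtain s' where s': "s' \<in> S" "(s', a0) \<in> E" using a0S[OF nup] unfolding Ss_def by auto
    have "a0 \<in> S" using a0S[OF that] unfolding Ss_def by auto
    moreover have "s' \<noteq> a0" using s' irr by auto
    moreover have "(p, s') \<notin> P1" using P1(3)[of p s'] that unfolding up_def by auto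
    ultimately have "(p, s') \<notin> Red" using RedD[of p s'] S[OF s'(1)] v Eu EaS[of p s'] by auto
    moreover have "(s', a0) \<in> E \<inter> S \<times> S" using s' \<open>a0 \<in> S\<close> by auto
    ultimately show ?thesis using s' S SS by blast
  qed
  have pw: "(p, w) \<in> ?Bl\<^sup>*"
  proof (cases "S = {}")
    case True then show ?thesis using w(3) unfolding Ss_def by auto
  next
    case False
    show ?thesis
    proof (cases up)
      case True
      have wS: "w \<in> S" using w(3) False unfolding Ss_def by auto
      have "(p, w) \<notin> E1"
      proof (cases "S = {w}")
        case True then show ?thesis using E1(1) unfolding D_def Es_def by auto
      next
        case False
        then have "w \<in> R" using w(3) \<open>S \<noteq> {}\<close> unfolding R_def by auto
        then show ?thesis using E1(3) by auto
      qed
      then have "(p, w) \<notin> Red" using RedD[of p w] S[OF wS] v Eu EaS[of p w] P1(1) True by auto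
      then show ?thesis using S[OF wS] by auto
    next
      case False
      then obtain s' where "s' \<in> S" "(p, s') \<in> ?Bl" using detour by auto
      then show ?thesis using Sw by (meson converse_rtrancl_into_rtrancl)
    qed
  qed
  have wv: "(z, v) \<in> ?Bl\<^sup>*" if "(z, v) \<in> Q\<^sup>*" for z
    using that
  proof (induction rule: converse_rtrancl_induct)
    case (step y z)
    have yz: "(y, z) \<in> D" "(y, z) \<notin> E1" using step(1) Q(1) F(1) E1(1) by auto
    consider "y = v" | "(y, z) \<in> Ea" | "(y, z) \<in> ?Bl"
      using RedD[of y z] yz P1(1) unfolding D_def by auto
    then show ?case
    proof cases
      case 2
      then obtain s' where "(y, s') \<in> ?Bl" "(s', z) \<in> ?Bl" using EaS[of y z] detour by auto
      then show ?thesis using step(3) by (meson converse_rtrancl_into_rtrancl)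
    next
      case 3
      then show ?thesis using step(3) by (rule converse_rtrancl_into_rtrancl)
    qed auto
  qed auto
  have "(w, v) \<in> Q\<^sup>*" using F(2)[OF vV] Q(4) by auto
  then have w_v: "(w, v) \<in> ?Bl\<^sup>*" by (rule wv)
  have blueV2: "(z, v) \<in> ?Bl\<^sup>*" if z: "z \<in> V2" for z
  proof -
    have p_v: "(p, v) \<in> ?Bl\<^sup>*" using pw w_v by (rule rtrancl_trans)
    consider "z = p" | "z = v" | "z \<in> S" | "z \<in> V2 - S - {p, v}" using z by auto
    then show ?thesis
    proof cases
      case 3 then show ?thesis using Sw w_v by (meson rtrancl_trans)
    next
      case 4 then show ?thesis using to_p p_v by (meson converse_rtrancl_into_rtrancl)
    qed (use p_v in auto)
  qed
  have blueV1: "(x, v) \<in> ?Bl\<^sup>*" if x: "x \<in> V1" for x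
  proof -
    have xn: "x \<notin> V2" "x \<noteq> p" "x \<noteq> v" using x disj pV v by auto
    have "\<exists>b. (x, b) \<in> ?Bl"
    proof (rule ccontr)
      assume "\<nexists>b. (x, b) \<in> ?Bl"
      then have no: "(x, b) \<in> Red" if "(x, b) \<in> E" for b using that by auto
      show False
      proof (cases "x = u")
        case True
        \<comment> \<open>All out-neighbours of \<open>u\<close> are dominated by \<open>v\<close>,
          so a red arc from \<open>u\<close> leads to \<open>p\<close> or belongs to
          \<open>P1\<close>. These are at most two arcs, too few for the out-degree.\<close>
        have ex: "\<exists>c. P1 `` {u} \<subseteq> {c}" using P1(2) unfolding single_valued_def by blast
        then obtain c where c: "P1 `` {u} \<subseteq> {c}" by auto
        have "E `` {u} \<subseteq> {p, c}"
        proof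
          fix b assume "b \<in> E `` {u}"
          then have "(u, b) \<in> Red" "(v, b) \<in> E" using no True out xn by auto
          then show "b \<in> {p, c}" using RedD[of u b] xn True Eu EaS[of u b] c by auto
        qed
        then have "card (E `` {u}) \<le> card {p, c}" by (intro card_mono) auto
        then show False using outdeg[OF x] True by (auto simp: card_insert_if split: if_splits)
      next
        case False
        \<comment> \<open>Here \<open>v\<close> is no root of the forest, so arcs into
          \<open>v\<close> may be red and stepping directly to \<open>v\<close> may fail. Three
          children are used instead: each two of them must be joined by an arc of \<open>Q\<close>,
          which is impossible in a forest.\<close>
        obtain T where T: "T \<subseteq> E `` {x}" "card T = 3" using obtain_subset_with_card_n[OF outdeg[OF x]] by auto
        then obtain b c d where T3: "T = {b, c, d}" "b \<noteq> c" "b \<noteq> d" "c \<noteq> d" by (auto simp: card_3_iff)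
        have kids: "(x, y) \<in> E1" "y \<in> V2" if "y \<in> T" for y
          using RedD[OF no, of y] T(1) that xn False Eu EaS[of x y] P1(1) V2_of_V1(1)[OF x] by auto
        have pair: "(y, z) \<in> Q \<or> (z, y) \<in> Q" if yz: "y \<in> T" "z \<in> T" "y \<noteq> z" for y z
        proof -
          have nR: "y \<notin> R" "z \<notin> R" using E1(3) kids yz by blast+
          have "(y, z) \<in> D \<or> (z, y) \<in> D"
            using semi[of y z] kids yz nR Eu unfolding D_def Es_def R_def by auto
          moreover have "(y, z) \<notin> D - Q" "(z, y) \<notin> D - Q"
            using sib[OF x kids(1)[OF yz(1)] kids(1)[OF yz(2)]] sib[OF x kids(1)[OF yz(2)] kids(1)[OF yz(1)]]
              yz kids disj by auto
          ultimately show ?thesis by auto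
        qed
        have sv: "y = y'" if "(y, z) \<in> Q" "(y', z) \<in> Q" for y y' z
          using that Q(2) unfolding single_valued_def by auto
        show False
          using pair[of b c] pair[of b d] pair[of c d] T3 sv Q(3)
          by (metis insertCI less_asym less_trans)
      qed
    qed
    then obtain b where b: "(x, b) \<in> ?Bl" by auto
    then have "b \<in> V2" using V2_of_V1(1)[OF x] by auto
    then show ?thesis using blueV2 converse_rtrancl_into_rtrancl[OF b] by auto
  qed
  show ?thesis
    by (rule arc_disjoint_reachI[OF RedE]) (use red blueV1 blueV2 in \<open>auto simp: V_def\<close>)
qed

section \<open>Roots in different parts\<close>

lemma hamiltonian_path3:
  assumes "T \<subseteq> V2" "3 \<le> card T"
  obtains a b c where "a \<in> T" "b \<in> T" "c \<in> T" "a \<noteq> b" "b \<noteq> c" "a \<noteq> c" "(a, b) \<in> E" "(b, c) \<in> E"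
proof -
  obtain T' where "T' \<subseteq> T" "card T' = 3" using obtain_subset_with_card_n[OF assms(2)] by auto
  then obtain a b c where T: "a \<in> T" "b \<in> T" "c \<in> T" "a \<noteq> b" "a \<noteq> c" "b \<noteq> c" by (auto simp: card_3_iff)
  have "(a, b) \<in> E \<or> (b, a) \<in> E" "(a, c) \<in> E \<or> (c, a) \<in> E" "(b, c) \<in> E \<or> (c, b) \<in> E"
    using semi T assms(1) by blast+
  then show thesis using T that by metis
qed

text \<open>In the remaining case \<open>v\<close> dominates all out-neighbours of \<open>u\<close>,
  and three of them form a path from \<open>a\<close> over \<open>b\<close> to \<open>c\<close>. If
  \<open>good_if_no_bypass\<close> fails for \<open>p = c\<close>, some \<open>y\<close> lies
  between \<open>c\<close> and \<open>v\<close>. Depending on the arcs between \<open>y\<close> and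
  \<open>a\<close>, \<open>b\<close>, the red path runs through \<open>c\<close> or through
  \<open>b\<close>; the predecessor on the path replaces the deleted arc from
  \<open>u\<close>.\<close>

lemma good_V1_V2:
  assumes u: "u \<in> V1" and v: "v \<in> V2"
  shows "arc_disjoint_reach V E u v"
proof (cases "(u, v) \<in> E \<or> (\<exists>p. (u, p) \<in> E \<and> (p, v) \<in> E)")
  case True
  then show ?thesis
    using good_at_target[of u v] good_if_arc[OF _ v] u v V2_of_V1(1)[OF u] unfolding root_via_def by blast
next
  case False
  let ?P = "E `` {u}"
  have P: "p \<in> V2" "p \<noteq> v" "(p, v) \<notin> E" "(v, p) \<in> E" "root_via u p" if "p \<in> ?P" for p
    using that False semi[of p v] v u V2_of_V1(1)[OF u, of p] unfolding root_via_def by auto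
  obtain a b c where abc: "a \<in> ?P" "b \<in> ?P" "c \<in> ?P" "a \<noteq> b" "b \<noteq> c" "a \<noteq> c" "(a, b) \<in> E" "(b, c) \<in> E"
    using hamiltonian_path3[of ?P] P(1) outdeg[OF u] by blast
  show ?thesis
  proof (cases "\<exists>y\<in>V2 - {c, v}. (y, c) \<notin> E \<and> (v, y) \<notin> E")
    case False
    then show ?thesis using good_if_no_bypass[OF P(5)[OF abc(3)] v P(2,3)[OF abc(3)]] P(4) by blast
  next
    case True
    then obtain y where y: "y \<in> V2" "y \<noteq> c" "y \<noteq> v" "(y, c) \<notin> E" "(v, y) \<notin> E" by auto
    then have cy: "(c, y) \<in> E" and yv: "(y, v) \<in> E" using semi P(1) abc v by blast+
    have yab: "y \<noteq> a" "y \<noteq> b" using y P(4) abc by auto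
    have un: "u \<notin> V2" using u disj by auto
    show ?thesis
    proof (cases "(y, a) \<in> E \<or> (y, b) \<in> E")
      case True
      have p2: "u = c \<or> (\<exists>p'. (u, p') \<in> E \<and> (p', c) \<in> E \<and> p' \<noteq> y \<and> p' \<noteq> v)"
        using abc yab P(2) by auto
      show ?thesis
      proof (cases "\<exists>s\<in>V2 - {c, y, v}. (s, c) \<notin> E \<and> (s, v) \<notin> E")
        case True
        then show ?thesis
          using good_if_two_path_sink[OF P(5)[OF abc(3)] v y(1) cy yv P(2)[OF abc(3)] p2] by blast
      next
        case no: False
        define B where "B = safe ({(u, c), (c, y), (y, v)} - Id) {u, c, y, v} v"
        \<comment> \<open>With \<open>w = c\<close>, the vertex \<open>y\<close> walks to
          \<open>c\<close> through \<open>a\<close> or \<open>b\<close>; arcs into \<open>a\<close>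
          and \<open>b\<close> are safe because \<open>v\<close> dominates both.\<close>
        have B: "(a, b) \<in> B" "(b, c) \<in> B" "(y, a) \<in> E \<Longrightarrow> (y, a) \<in> B" "(y, b) \<in> E \<Longrightarrow> (y, b) \<in> B"
          using abc P y yab un unfolding B_def safe_def by auto
        then have "(y, c) \<in> B\<^sup>*" using True by (meson converse_rtrancl_into_rtrancl rtrancl.rtrancl_refl)
        then show ?thesis
          using good_if_two_path[OF P(5)[OF abc(3)] v y(1) cy yv P(2)[OF abc(3)] p2 refl B_def, of c] P(1)[OF abc(3)] no by blast
      qed
    next
      case False
      then have by_: "(b, y) \<in> E" using semi[of b y] y yab P abc by auto
      have p2: "u = b \<or> (\<exists>p'. (u, p') \<in> E \<and> (p', b) \<in> E \<and> p' \<noteq> y \<and> p' \<noteq> v)"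
        using abc yab P(2) by auto
      show ?thesis
      proof (cases "\<exists>s\<in>V2 - {b, y, v}. (s, b) \<notin> E \<and> (s, v) \<notin> E")
        case True
        then show ?thesis
          using good_if_two_path_sink[OF P(5)[OF abc(2)] v y(1) by_ yv P(2)[OF abc(2)] p2] by blast
      next
        case no: False
        define B where "B = safe ({(u, b), (b, y), (y, v)} - Id) {u, b, y, v} v"
        \<comment> \<open>With \<open>w = y\<close>, the blue walk from \<open>b\<close> avoids the
          reserved arc by passing through \<open>c\<close>.\<close>
        have "(b, c) \<in> B" "(c, y) \<in> B"
          using abc P y yab un cy unfolding B_def safe_def by auto
        then have "(b, y) \<in> B\<^sup>*" by (meson converse_rtrancl_into_rtrancl rtrancl.rtrancl_refl)
        then show ?thesis
          using good_if_two_path[OF P(5)[OF abc(2)] v y(1) by_ yv P(2)[OF abc(2)] p2 refl B_def, of y] y no by blast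
      qed
    qed
  qed
qed

text \<open>Of the arcs left uncoloured, those from \<open>V2\<close> to \<open>V1\<close> become
  red and the others blue, so a vertex of \<open>V1\<close> needs only an in-arc that is not blue
  and an out-arc that is not red.\<close>

lemma good_if_colouring_of_V2:
  assumes "Red \<subseteq> E" "Blue \<subseteq> E" "Red \<inter> Blue = {}"
    and red: "\<And>x. x \<in> V2 \<Longrightarrow> (u, x) \<in> Red\<^sup>*" and blue: "\<And>x. x \<in> V2 \<Longrightarrow> (x, v) \<in> Blue\<^sup>*"
    and red1: "\<And>x. x \<in> V1 \<Longrightarrow> (u, x) \<in> Red\<^sup>* \<or> (\<exists>a. (a, x) \<in> E - Blue)"
    and blue1: "\<And>x. x \<in> V1 \<Longrightarrow> (x, v) \<in> Blue\<^sup>* \<or> (\<exists>b. (x, b) \<in> E - Red)"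
  shows "arc_disjoint_reach V E u v"
proof (rule arc_disjoint_reachI)
  define R where "R = Red \<union> ((E - Blue) \<inter> V2 \<times> V1)"
  show "R \<subseteq> E" using assms unfolding R_def by auto
  have mono: "Red\<^sup>* \<subseteq> R\<^sup>*" "Blue\<^sup>* \<subseteq> (E - R)\<^sup>*"
    by (rule rtrancl_mono; use assms(2,3) R_def in auto)+
  fix x assume x: "x \<in> V"
  show "(u, x) \<in> R\<^sup>*"
  proof (cases "x \<in> V2 \<or> (u, x) \<in> Red\<^sup>*")
    case True then show ?thesis using red mono by auto
  next
    case False
    then obtain a where "x \<in> V1" "(a, x) \<in> E - Blue" using x red1 unfolding V_def by auto
    then have "a \<in> V2" "(a, x) \<in> R" using V2_of_V1(2)[of x a] unfolding R_def by auto
    then show ?thesis using red mono by (meson rtrancl_into_rtrancl subsetD)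
  qed
  show "(x, v) \<in> (E - R)\<^sup>*"
  proof (cases "x \<in> V2 \<or> (x, v) \<in> Blue\<^sup>*")
    case True then show ?thesis using blue mono by auto
  next
    case False
    then obtain b where "x \<in> V1" "(x, b) \<in> E - Red" using x blue1 unfolding V_def by auto
    then have "b \<in> V2" "(x, b) \<in> E - R" using V2_of_V1(1)[of x b] disj unfolding R_def by auto
    then show ?thesis using blue mono by (meson converse_rtrancl_into_rtrancl subsetD)
  qed
qed

lemma out_other: "x \<in> V1 \<Longrightarrow> \<exists>b. (x, b) \<in> E \<and> b \<in> V2 \<and> b \<noteq> c"
proof -
  assume x: "x \<in> V1"
  have "\<not> E `` {x} \<subseteq> {c}" using outdeg[OF x] card_mono[of "{c}" "E `` {x}"] by auto
  then show ?thesis using V2_of_V1(1)[OF x] by auto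
qed

end

section \<open>Both roots in the same part\<close>

locale split_relation_in = split_relation +
  assumes indeg: "x \<in> V1 \<Longrightarrow> 3 \<le> card (E\<inverse> `` {x})"
begin

lemma dual: "split_relation_in V1 V2 (E\<inverse>)"
proof unfold_locales
  show "two_arc_strong (V1 \<union> V2) (E\<inverse>)"
    unfolding two_arc_strong_def
  proof (intro allI impI)
    fix X assume X: "X \<subseteq> V1 \<union> V2" "X \<noteq> {}" "X \<noteq> V1 \<union> V2"
    have "entering (E\<inverse>) X = (entering E (V - X))\<inverse>" using EV X unfolding V_def by auto
    moreover have "2 \<le> card (entering E (V - X))"
    proof -
      obtain x where "x \<in> X" using X by auto
      then show ?thesis using two_cut[of "V - X" x] X unfolding V_def by auto
    qed
    ultimately show "2 \<le> card (entering (E\<inverse>) X)" by (simp add: card_inverse)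
  qed
qed (use fin disj EV irr indep semi outdeg indeg in \<open>auto simp: V_def\<close>)

lemma in_other: "x \<in> V1 \<Longrightarrow> \<exists>b. (b, x) \<in> E \<and> b \<in> V2 \<and> b \<noteq> c"
proof -
  assume x: "x \<in> V1"
  have "\<not> E\<inverse> `` {x} \<subseteq> {c}" using indeg[OF x] card_mono[of "{c}" "E\<inverse> `` {x}"] by auto
  then show ?thesis using V2_of_V1(2)[OF x] by auto
qed

text \<open>The configuration left over when both roots lie in \<open>V2\<close>. Three vertices of
  \<open>C\<close> carry disjoint walks of both colours; if \<open>C\<close> is smaller, a detour
  through a vertex \<open>x0\<close> of \<open>V1\<close> replaces the missing arcs.\<close>

lemma good_if_rest_between_roots:
  assumes uv: "u \<in> V2" "v \<in> V2" "u \<noteq> v" and V1: "V1 \<noteq> {}"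
    and C: "C = V2 - {u, v}" "C \<noteq> {}" "\<And>c. c \<in> C \<Longrightarrow> (u, c) \<in> E \<and> (c, v) \<in> E"
  shows "arc_disjoint_reach V E u v"
proof -
  have finC: "finite C" using fin C(1) unfolding V_def by auto
  have nV1: "u \<notin> V1" "v \<notin> V1" "\<And>c. c \<in> C \<Longrightarrow> c \<notin> V1" "\<And>c. c \<in> C \<Longrightarrow> c \<noteq> u \<and> c \<noteq> v"
    using uv C disj by auto
  have V2: "V2 = {u, v} \<union> C" using uv C(1) by auto
  consider "3 \<le> card C" | "card C = 2" | "card C = 1" using C(2) finC by (metis card_gt_0_iff
      Suc_leI One_nat_def le_neq_implies_less numeral_2_eq_2 numeral_3_eq_3)
  then show ?thesis
  proof cases
    case 1
    then obtain a b c where abc: "a \<in> C" "b \<in> C" "c \<in> C" "a \<noteq> b" "b \<noteq> c" "a \<noteq> c" "(a, b) \<in> E" "(b, c) \<in> E"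
      using hamiltonian_path3[of C] C(1) by auto
    \<comment> \<open>Red uses \<open>u\<close>, \<open>a\<close>, \<open>v\<close> and the arc from
      \<open>b\<close> to \<open>c\<close>; blue uses \<open>u\<close>, \<open>c\<close>,
      \<open>v\<close> and the walk from \<open>a\<close> through \<open>b\<close> to
      \<open>v\<close>.\<close>
    define Red where "Red = {(a, v), (b, c)} \<union> {u} \<times> (C - {c})"
    define Blue where "Blue = {(a, b), (u, c)} \<union> (C - {a}) \<times> {v}"
    show ?thesis
    proof (rule good_if_colouring_of_V2[of Red Blue])
      show "Red \<subseteq> E" "Blue \<subseteq> E" "Red \<inter> Blue = {}" using abc C(3) nV1 unfolding Red_def Blue_def by auto
      have R: "(u, a) \<in> Red" "(u, b) \<in> Red" "(a, v) \<in> Red" "(b, c) \<in> Red" "\<And>z. z \<in> C - {c} \<Longrightarrow> (u, z) \<in> Red"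
        using abc unfolding Red_def by auto
      then have "(u, v) \<in> Red\<^sup>*" "(u, c) \<in> Red\<^sup>*" by (meson r_into_rtrancl rtrancl_into_rtrancl)+
      then show "(u, x) \<in> Red\<^sup>*" if "x \<in> V2" for x using that R(5) unfolding V2 by blast
      have R: "(u, c) \<in> Blue" "(a, b) \<in> Blue" "\<And>z. z \<in> C - {a} \<Longrightarrow> (z, v) \<in> Blue"
        using abc unfolding Blue_def by auto
      moreover have "(c, v) \<in> Blue" "(b, v) \<in> Blue" using abc unfolding Blue_def by auto
      ultimately have "(u, v) \<in> Blue\<^sup>*" "(a, v) \<in> Blue\<^sup>*" by (meson r_into_rtrancl rtrancl_into_rtrancl)+
      then show "(x, v) \<in> Blue\<^sup>*" if "x \<in> V2" for x using that R(3) unfolding V2 by blast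
      show "(u, x) \<in> Red\<^sup>* \<or> (\<exists>a. (a, x) \<in> E - Blue)" if "x \<in> V1" for x
        using in_other[OF that, of u] that abc nV1 unfolding Blue_def by auto
      show "(x, v) \<in> Blue\<^sup>* \<or> (\<exists>b. (x, b) \<in> E - Red)" if "x \<in> V1" for x
        using out_other[OF that, of u] that abc nV1 unfolding Red_def by auto
    qed
  next
    case 2
    then obtain a' b' where "C = {a', b'}" "a' \<noteq> b'" by (auto simp: card_2_iff)
    moreover have "(a', b') \<in> E \<or> (b', a') \<in> E" using semi[of a' b'] calculation C(1) by auto
    ultimately obtain a b where ab: "C = {a, b}" "a \<noteq> b" "(a, b) \<in> E" by blast
    have ua: "(u, a) \<in> E" "(u, b) \<in> E" "(a, v) \<in> E" "(b, v) \<in> E" using C(3) ab by auto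
    have n: "a \<notin> V1" "b \<notin> V1" "a \<noteq> u" "a \<noteq> v" "b \<noteq> u" "b \<noteq> v" using nV1 ab by auto
    have V2': "V2 = {u, v, a, b}" using V2 ab by auto
    show ?thesis
    proof (cases "\<exists>x\<in>V1. (u, x) \<in> E")
      case True
      then obtain x0 where x0: "x0 \<in> V1" "(u, x0) \<in> E" by auto
      obtain d where d: "(x0, d) \<in> E" "d \<in> V2" "d \<noteq> u" using out_other[OF x0(1)] by auto
      have xn: "x0 \<noteq> u" "x0 \<noteq> v" "x0 \<noteq> a" "x0 \<noteq> b" using x0 nV1 n by auto
      define Red where "Red = {(u, a), (u, b), (a, v)}"
      \<comment> \<open>Both arcs from \<open>u\<close> into \<open>C\<close> are red, so
        \<open>u\<close> walks through \<open>x0\<close> to some \<open>d\<close> other than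
        \<open>u\<close>.\<close>
      define Blue where "Blue = {(u, x0), (x0, d), (a, b), (b, v)}"
      show ?thesis
      proof (rule good_if_colouring_of_V2[of Red Blue])
        show "Red \<subseteq> E" "Blue \<subseteq> E" "Red \<inter> Blue = {}" using ab ua x0 d xn n unfolding Red_def Blue_def by auto
        have "(u, a) \<in> Red" "(u, b) \<in> Red" "(a, v) \<in> Red" unfolding Red_def by auto
        then have "(u, a) \<in> Red\<^sup>*" "(u, b) \<in> Red\<^sup>*" "(u, v) \<in> Red\<^sup>*" by (meson r_into_rtrancl rtrancl_into_rtrancl)+
        then show "(u, x) \<in> Red\<^sup>*" if "x \<in> V2" for x using that unfolding V2' by auto
        have B: "(u, x0) \<in> Blue" "(x0, d) \<in> Blue" "(a, b) \<in> Blue" "(b, v) \<in> Blue" unfolding Blue_def by auto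
        then have B': "(a, v) \<in> Blue\<^sup>*" "(b, v) \<in> Blue\<^sup>*" by (meson r_into_rtrancl rtrancl_into_rtrancl)+
        then have "(d, v) \<in> Blue\<^sup>*" using d unfolding V2' by auto
        then have "(u, v) \<in> Blue\<^sup>*" using B by (meson converse_rtrancl_into_rtrancl)
        then show "(x, v) \<in> Blue\<^sup>*" if "x \<in> V2" for x using that B' unfolding V2' by auto
        show "(u, x) \<in> Red\<^sup>* \<or> (\<exists>a. (a, x) \<in> E - Blue)" if "x \<in> V1" for x
          using in_other[OF that, of u] that n nV1 d disj unfolding Blue_def by auto
        show "(x, v) \<in> Blue\<^sup>* \<or> (\<exists>b. (x, b) \<in> E - Red)" if "x \<in> V1" for x
          using out_other[OF that, of u] that n nV1 unfolding Red_def by auto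
      qed
    next
      case False
      obtain x0 where x0: "x0 \<in> V1" using V1 by auto
      have "E\<inverse> `` {x0} \<subseteq> V2 - {u}" using False x0 V2_of_V1(2)[OF x0] by auto
      moreover have "(a, x0) \<in> E"
      proof (rule ccontr)
        assume "(a, x0) \<notin> E"
        then have "E\<inverse> `` {x0} \<subseteq> {v, b}" using calculation V2' by auto
        then have "card (E\<inverse> `` {x0}) \<le> card {v, b}" by (intro card_mono) auto
        then show False using indeg[OF x0] n by auto
      qed
      moreover obtain d where d: "(x0, d) \<in> E" "d \<in> V2" "d \<noteq> a" using out_other[OF x0(1)] by auto
      ultimately have x0a: "(a, x0) \<in> E" by auto
      have xn: "x0 \<noteq> u" "x0 \<noteq> v" "x0 \<noteq> a" "x0 \<noteq> b" using x0 nV1 n by auto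
      define Red where "Red = {(u, a), (a, v), (a, b)}"
      \<comment> \<open>All arcs from \<open>a\<close> into \<open>V2\<close> that are known are
        red, so now \<open>a\<close> takes the detour through \<open>x0\<close>, to some
        \<open>d\<close> other than \<open>a\<close>.\<close>
      define Blue where "Blue = {(u, b), (b, v), (a, x0), (x0, d)}"
      show ?thesis
      proof (rule good_if_colouring_of_V2[of Red Blue])
        show "Red \<subseteq> E" "Blue \<subseteq> E" "Red \<inter> Blue = {}" using ab ua x0 x0a d xn n unfolding Red_def Blue_def by auto
        have "(u, a) \<in> Red" "(a, b) \<in> Red" "(a, v) \<in> Red" unfolding Red_def by auto
        then have "(u, a) \<in> Red\<^sup>*" "(u, b) \<in> Red\<^sup>*" "(u, v) \<in> Red\<^sup>*" by (meson r_into_rtrancl rtrancl_into_rtrancl)+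
        then show "(u, x) \<in> Red\<^sup>*" if "x \<in> V2" for x using that unfolding V2' by auto
        have B: "(u, b) \<in> Blue" "(x0, d) \<in> Blue" "(a, x0) \<in> Blue" "(b, v) \<in> Blue" unfolding Blue_def by auto
        then have B': "(u, v) \<in> Blue\<^sup>*" "(b, v) \<in> Blue\<^sup>*" by (meson r_into_rtrancl rtrancl_into_rtrancl)+
        then have "(d, v) \<in> Blue\<^sup>*" using d unfolding V2' by auto
        then have "(a, v) \<in> Blue\<^sup>*" using B by (meson converse_rtrancl_into_rtrancl)
        then show "(x, v) \<in> Blue\<^sup>*" if "x \<in> V2" for x using that B' unfolding V2' by auto
        show "(u, x) \<in> Red\<^sup>* \<or> (\<exists>a. (a, x) \<in> E - Blue)" if "x \<in> V1" for x
          using in_other[OF that, of a] that n nV1 d disj unfolding Blue_def by auto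
        show "(x, v) \<in> Blue\<^sup>* \<or> (\<exists>b. (x, b) \<in> E - Red)" if "x \<in> V1" for x
          using out_other[OF that, of u] that n nV1 unfolding Red_def by auto
      qed
    qed
  next
    case 3
    then obtain y where y: "C = {y}" by (auto simp: card_1_singleton_iff)
    have V2': "V2 = {u, v, y}" "y \<noteq> u" "y \<noteq> v" using V2 y nV1 by auto
    then have c3: "card V2 = 3" "finite V2" using uv by auto
    obtain x0 where x0: "x0 \<in> V1" using V1 by auto
    \<comment> \<open>With only three vertices in \<open>V2\<close>, the degree bounds join
      \<open>x0\<close> to all of them in both directions.\<close>
    have "E `` {x0} = V2" using V2_of_V1[OF x0] outdeg[OF x0] c3 by (intro card_seteq) auto
    moreover have "E\<inverse> `` {x0} = V2" using V2_of_V1[OF x0] indeg[OF x0] c3 by (intro card_seteq) auto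
    ultimately have x: "(x0, v) \<in> E" "(u, x0) \<in> E" "(y, x0) \<in> E" "(v, x0) \<in> E" using V2' by auto
    have n: "x0 \<noteq> u" "x0 \<noteq> v" "x0 \<noteq> y" "y \<notin> V1" using x0 nV1 y by auto
    define Red where "Red = {(u, y), (y, v)}"
    define Blue where "Blue = {(u, x0), (y, x0), (x0, v)}"
    show ?thesis
    proof (rule good_if_colouring_of_V2[of Red Blue])
      show "Red \<subseteq> E" "Blue \<subseteq> E" "Red \<inter> Blue = {}" using C(3) y x n unfolding Red_def Blue_def by auto
      have "(u, y) \<in> Red" "(y, v) \<in> Red" unfolding Red_def by auto
      then have "(u, y) \<in> Red\<^sup>*" "(u, v) \<in> Red\<^sup>*" by (meson r_into_rtrancl rtrancl_into_rtrancl)+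
      then show "(u, x) \<in> Red\<^sup>*" if "x \<in> V2" for x using that unfolding V2' by auto
      have B: "(u, x0) \<in> Blue" "(x0, v) \<in> Blue" "(y, x0) \<in> Blue" unfolding Blue_def by auto
      then have "(u, v) \<in> Blue\<^sup>*" "(y, v) \<in> Blue\<^sup>*" by (meson r_into_rtrancl rtrancl_into_rtrancl)+
      then show "(x, v) \<in> Blue\<^sup>*" if "x \<in> V2" for x using that unfolding V2' by auto
      show "(u, x) \<in> Red\<^sup>* \<or> (\<exists>a. (a, x) \<in> E - Blue)" if "x \<in> V1" for x
      proof (cases "x = x0")
        case True
        then have "(v, x) \<in> E - Blue" using x n uv V2' unfolding Blue_def by auto
        then show ?thesis by blast
      next
        case False
        then show ?thesis using in_other[OF that, of u] that nV1 unfolding Blue_def by auto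
      qed
      show "(x, v) \<in> Blue\<^sup>* \<or> (\<exists>b. (x, b) \<in> E - Red)" if "x \<in> V1" for x
        using out_other[OF that, of u] that n nV1 unfolding Red_def by auto
    qed
  qed
qed

end

section \<open>Both roots in \<open>V2\<close>\<close>

context split_relation
begin

text \<open>A vertex violating the first claim is a sink for \<open>good_if_two_path_sink\<close>.
  If one of the other claims failed, \<open>y\<close> would reach \<open>u\<close> along safe arcs
  and \<open>w = u\<close> would satisfy \<open>good_if_two_path\<close>.\<close>

lemma two_path_consequences:
  assumes ng: "\<not> arc_disjoint_reach V E u v" and u: "u \<in> V2" and v: "v \<in> V2" "u \<noteq> v"
    and y: "y \<in> V2" "(u, y) \<in> E" "(y, v) \<in> E"
  shows "s \<in> V2 - {u, v} \<Longrightarrow> (s, u) \<in> E \<or> (s, v) \<in> E"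
    and "(y, u) \<notin> E"
    and "(v, r) \<in> E \<Longrightarrow> (r, u) \<in> E \<Longrightarrow> (y, r) \<notin> E"
proof -
  have lu: "root_via u u" using u unfolding root_via_def by auto
  show S: "(s, u) \<in> E \<or> (s, v) \<in> E" if "s \<in> V2 - {u, v}" for s
    using good_if_two_path_sink[OF lu v(1) y v(2)] that ng y by blast
  define B where "B = safe ({(u, u), (u, y), (y, v)} - Id) {u, u, y, v} v"
  have n: "(y, u) \<notin> B\<^sup>*"
    using good_if_two_path[OF lu v(1) y v(2) _ refl B_def, of u] ng S u by auto
  have yv: "y \<noteq> v" "y \<noteq> u" using y irr by auto
  have "(y, u) \<in> E \<Longrightarrow> (y, u) \<in> B" using yv v unfolding B_def safe_def by auto
  then show "(y, u) \<notin> E" using n by auto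
  assume r: "(v, r) \<in> E" "(r, u) \<in> E"
  show "(y, r) \<notin> E"
  proof
    assume "(y, r) \<in> E"
    then have "(y, r) \<in> B" "(r, u) \<in> B" using r yv v irr unfolding B_def safe_def by auto
    then show False using n by (meson r_into_rtrancl rtrancl_into_rtrancl)
  qed
qed

end

context split_relation_in
begin

text \<open>In a counterexample some \<open>y\<close> lies between \<open>u\<close> and
  \<open>v\<close>. The consequences for \<open>E\<close> and for its converse show that every other
  vertex of \<open>V2\<close> does so as well, which \<open>good_if_rest_between_roots\<close>
  settles.\<close>

lemma good_V2_V2:
  assumes u: "u \<in> V2" and v: "v \<in> V2" and V1: "V1 \<noteq> {}"
  shows "arc_disjoint_reach V E u v"
proof (rule ccontr)
  assume ng: "\<not> arc_disjoint_reach V E u v"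
  interpret d: split_relation_in V1 V2 "E\<inverse>" by (rule dual)
  have ngd: "\<not> arc_disjoint_reach V (E\<inverse>) v u" using arc_disjoint_reach_converse ng by metis
  have lu: "root_via u u" using u unfolding root_via_def by auto
  have uv: "u \<noteq> v" "(u, v) \<notin> E"
    using good_at_target[of u v] good_if_arc[OF lu v] lu ng unfolding root_via_def by auto
  have vu: "v \<noteq> u" using uv by auto
  obtain y where y: "y \<in> V2" "y \<noteq> u" "y \<noteq> v" "(y, u) \<notin> E" "(v, y) \<notin> E"
    using good_if_no_bypass[OF lu v uv] ng by blast
  then have yuv: "(u, y) \<in> E" "(y, v) \<in> E" using semi u v by blast+
  \<comment> \<open>Such an \<open>r\<close> could be joined to \<open>y\<close> in neither
    direction, by the third consequence and its dual.\<close>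
  have nW: "\<not> ((v, r) \<in> E \<and> (r, u) \<in> E)" if r: "r \<in> V2 - {u, v}" for r
  proof
    assume vr: "(v, r) \<in> E \<and> (r, u) \<in> E"
    then have "(y, r) \<notin> E" "(r, y) \<notin> E"
      using two_path_consequences(3)[OF ng u v uv(1) y(1) yuv, of r]
        d.two_path_consequences(3)[OF ngd v u vu y(1), of r] yuv by auto
    then show False using semi[of y r] y r vr by auto
  qed
  have "(u, r) \<in> E \<and> (r, v) \<in> E" if r: "r \<in> V2 - {u, v}" for r
  proof -
    have "(r, u) \<in> E \<or> (r, v) \<in> E" "(u, r) \<in> E \<or> (v, r) \<in> E"
      using two_path_consequences(1)[OF ng u v uv(1) y(1) yuv, of r]
        d.two_path_consequences(1)[OF ngd v u vu y(1), of r] yuv r by auto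
    then show ?thesis using nW[OF r] semi[of u r] semi[of r v] u v r by auto
  qed
  then show False using good_if_rest_between_roots[OF u v uv(1) V1 refl] ng y by auto
qed

text \<open>The deletion affects no out-degree in \<open>V1\<close>, so \<open>good_V1_V2\<close>
  applies with target \<open>q\<close>. The deleted arc is then free to be the last blue
  arc.\<close>

lemma good_if_strong_without_last:
  assumes v: "v \<in> V1" and u: "u \<in> V1" and q: "(q, v) \<in> E" and two: "two_arc_strong V (E - {(q, v)})"
  shows "arc_disjoint_reach V E u v"
proof -
  have qV: "q \<in> V2" using V2_of_V1(2)[OF v q] .
  have out: "(E - {(q, v)}) `` {x} = E `` {x}" if "x \<in> V1" for x using that qV disj by auto
  interpret s: split_relation V1 V2 "E - {(q, v)}"
  proof unfold_locales
    show "(x, y) \<in> E - {(q, v)} \<or> (y, x) \<in> E - {(q, v)}" if "x \<in> V2" "y \<in> V2" "x \<noteq> y" for x y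
      using semi[OF that] that v disj by auto
  qed (use fin disj EV irr indep two outdeg out in \<open>auto simp: V_def\<close>)
  obtain Red where R: "Red \<subseteq> E - {(q, v)}" "\<forall>x\<in>V. (u, x) \<in> Red\<^sup>*" "\<forall>x\<in>V. (x, q) \<in> (E - {(q, v)} - Red)\<^sup>*"
    using s.good_V1_V2[OF u qV] unfolding arc_disjoint_reach_def by auto
  show ?thesis
  proof (rule arc_disjoint_reachI[of Red])
    have "(q, v) \<in> E - Red" using q R by auto
    moreover have "(x, q) \<in> (E - Red)\<^sup>*" if "x \<in> V" for x
      using R(3) that rtrancl_mono[of "E - {(q, v)} - Red" "E - Red"] by auto
    ultimately show "(x, v) \<in> (E - Red)\<^sup>*" if "x \<in> V" for x
      using that by (meson rtrancl_into_rtrancl)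
  qed (use R in auto)
qed

text \<open>
  If no arc into \<open>v\<close> can be deleted, each in-neighbour \<open>q\<close> lies outside a tight set \<open>X q\<close> containing \<open>v\<close>.
  By submodularity any two of these sets cover \<open>V\<close>, so each \<open>q\<close> has at most one out-neighbour
  among the in-neighbours of \<open>v\<close>, which leaves a directed triangle.
\<close>

lemma all_last_critical:
  assumes v: "v \<in> V1" and crit: "\<forall>q. (q, v) \<in> E \<longrightarrow> \<not> two_arc_strong V (E - {(q, v)})"
  shows "\<exists>a b c. E\<inverse> `` {v} = {a, b, c} \<and> a \<noteq> b \<and> b \<noteq> c \<and> a \<noteq> c \<and> a \<in> V2 \<and> b \<in> V2 \<and> c \<in> V2 \<and>
    E `` {a} = {v, b} \<and> E `` {b} = {v, c} \<and> E `` {c} = {v, a}"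
proof -
  define A where "A = E\<inverse> `` {v}"
  have AV: "A \<subseteq> V2" using V2_of_V1(2)[OF v] unfolding A_def by auto
  have vV: "v \<in> V" "v \<notin> V2" using v disj unfolding V_def by auto
  have finent: "finite (entering E X)" for X using finE by auto
  have "\<forall>q\<in>A. \<exists>X e. X \<subseteq> V \<and> v \<in> X \<and> q \<notin> X \<and> entering E X \<subseteq> {(q, v), e}"
  proof
    fix q assume "q \<in> A"
    then have q: "(q, v) \<in> E" unfolding A_def by auto
    obtain X where X: "X \<subseteq> V" "X \<noteq> {}" "X \<noteq> V" "\<not> 2 \<le> card (entering (E - {(q, v)}) X)"
      using crit q unfolding two_arc_strong_def by blast
    have "2 \<le> card (entering E X)" using X(1-3) two unfolding two_arc_strong_def by blast
    then have "entering (E - {(q, v)}) X \<noteq> entering E X" using X(4) by metis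
    then have vX: "v \<in> X" "q \<notin> X" by auto
    have X4: "card (entering (E - {(q, v)}) X) \<le> Suc 0" using X(4) by linarith
    have f: "finite (entering (E - {(q, v)}) X)" using finE by auto
    obtain e where e: "entering (E - {(q, v)}) X \<subseteq> {e}"
      using subset_singleton_if_card_le[OF f X4] .
    have "entering E X \<subseteq> {(q, v), e}" using e by auto
    then show "\<exists>X e. X \<subseteq> V \<and> v \<in> X \<and> q \<notin> X \<and> entering E X \<subseteq> {(q, v), e}" using X(1) vX by blast
  qed
  then obtain X e where "\<forall>q\<in>A. X q \<subseteq> V \<and> v \<in> X q \<and> q \<notin> X q \<and> entering E (X q) \<subseteq> {(q, v), e q}"
    by metis
  then have X: "X q \<subseteq> V" "v \<in> X q" "q \<notin> X q" "entering E (X q) \<subseteq> {(q, v), e q}" if "q \<in> A" for q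
    using that by auto
  have inA: "(q, v) \<in> E" if "q \<in> A" for q using that unfolding A_def by auto
  have c2: "card (entering E (X q)) \<le> 2" if "q \<in> A" for q
    using card_mono[OF _ X(4)[OF that]] by (simp add: card_insert_if split: if_splits)
  have enter: "(s, t) = (q, v) \<or> (s, t) = e q" if "q \<in> A" "(s, t) \<in> E" "s \<notin> X q" "t \<in> X q" for q s t
    using X(4)[OF that(1)] that by auto
  \<comment> \<open>If the union is not all of \<open>V\<close>, submodularity leaves only
    \<open>(q, v)\<close> and \<open>(q', v)\<close> entering the intersection. Then
    \<open>r\<close> lies inside, since \<open>(r, v)\<close> does not enter, and an arc from
    \<open>q\<close> or \<open>q'\<close> to \<open>r\<close> would enter.\<close>
  have cross: "(q, r) \<notin> E \<and> (q', r) \<notin> E"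
    if A: "q \<in> A" "q' \<in> A" "r \<in> A" "q \<noteq> q'" "r \<noteq> q" "r \<noteq> q'" and ne: "X q \<union> X q' \<noteq> V" for q q' r
  proof -
    have "X q \<union> X q' \<subseteq> V" "X q \<union> X q' \<noteq> {}" using X(1,2)[OF A(1)] X(1)[OF A(2)] by auto
    then have "2 \<le> card (entering E (X q \<union> X q'))" using two ne unfolding two_arc_strong_def by blast
    then have le: "card (entering E (X q \<inter> X q')) \<le> 2"
      using entering_submodular[OF finE, of "X q" "X q'"] c2[OF A(1)] c2[OF A(2)] by linarith
    have in2: "{(q, v), (q', v)} \<subseteq> entering E (X q \<inter> X q')"
      using inA[OF A(1)] inA[OF A(2)] X(2,3)[OF A(1)] X(2,3)[OF A(2)] by auto
    have "card {(q, v), (q', v)} = 2" using A(4) by simp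
    then have eq: "entering E (X q \<inter> X q') = {(q, v), (q', v)}"
      using card_seteq[OF finent in2] le by simp
    have r_in: "r \<in> X q \<inter> X q'"
    proof (rule ccontr)
      assume "r \<notin> X q \<inter> X q'"
      then have "(r, v) \<in> entering E (X q \<inter> X q')"
        using inA[OF A(3)] X(2)[OF A(1)] X(2)[OF A(2)] by auto
      then show False unfolding eq using A(5,6) by auto
    qed
    have "r \<noteq> v" using AV A(3) vV by auto
    moreover have "(q, r) \<in> entering E (X q \<inter> X q')" if "(q, r) \<in> E"
      using that r_in X(3)[OF A(1)] by auto
    moreover have "(q', r) \<in> entering E (X q \<inter> X q')" if "(q', r) \<in> E"
      using that r_in X(3)[OF A(2)] by auto
    ultimately show ?thesis unfolding eq by auto
  qed
  have card3: "3 \<le> card A" using indeg[OF v] unfolding A_def .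
  have cover: "X q \<union> X q' = V" if A: "q \<in> A" "q' \<in> A" "q \<noteq> q'" for q q'
  proof (rule ccontr)
    assume ne: "X q \<union> X q' \<noteq> V"
    have "\<not> A \<subseteq> {q, q'}" using card3 card_mono[of "{q, q'}" A] A by auto
    then obtain r where r: "r \<in> A" "r \<noteq> q" "r \<noteq> q'" by auto
    have c: "(q, r) \<notin> E" "(q', r) \<notin> E" using cross[OF A(1,2) r(1) A(3) r(2,3) ne] by auto
    \<comment> \<open>As \<open>r\<close> dominates both \<open>q\<close> and \<open>q'\<close>,
      applying \<open>cross\<close> to \<open>r\<close> and either of them puts both into
      \<open>X r\<close>. Thus two arcs besides \<open>(r, v)\<close> enter \<open>X r\<close>, one
      too many.\<close>
    then have rq: "(r, q) \<in> E" "(r, q') \<in> E" using semi[of q r] semi[of q' r] A r AV by auto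
    have "X r \<union> X q = V" using cross[of r q q'] A r rq by blast
    then have q_in: "q \<in> X r" using X(3)[OF A(1)] A AV unfolding V_def by auto
    have "X r \<union> X q' = V" using cross[of r q' q] A r rq by blast
    then have q'_in: "q' \<in> X r" using X(3)[OF A(2)] A AV unfolding V_def by auto
    have "q \<noteq> v" "q' \<noteq> v" using A vV AV by auto
    then have "e r = (r, q)" "e r = (r, q')"
      using enter[OF r(1) rq(1) X(3)[OF r(1)] q_in] enter[OF r(1) rq(2) X(3)[OF r(1)] q'_in] by auto
    then show False using A(3) by simp
  qed
  have other_in: "q' \<in> X q" if "q \<in> A" "q' \<in> A" "q \<noteq> q'" for q q'
    using cover[OF that] X(3)[OF that(2)] that(2) AV unfolding V_def by auto
  have eq_e: "e q = (q, q')" if "q \<in> A" "q' \<in> A" "(q, q') \<in> E" for q q'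
  proof -
    have "q \<noteq> q'" "q' \<noteq> v" using that irr AV vV by auto
    then show ?thesis using enter[OF that(1,3) X(3)[OF that(1)]] other_in[OF that(1,2)] by auto
  qed
  obtain a b c where abc: "a \<in> A" "b \<in> A" "c \<in> A" "a \<noteq> b" "b \<noteq> c" "a \<noteq> c" "(a, b) \<in> E" "(b, c) \<in> E"
    using hamiltonian_path3[OF AV card3] by auto
  have uniq: "q' = r" if "q \<in> A" "q' \<in> A" "r \<in> A" "(q, q') \<in> E" "(q, r) \<in> E" for q q' r
    using eq_e[of q q'] eq_e[of q r] that by auto
  have ca: "(c, a) \<in> E" using uniq[of a b c] semi[of a c] abc AV by auto
  have "A \<subseteq> {a, b, c}"
  proof
    fix d assume d: "d \<in> A"
    show "d \<in> {a, b, c}"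
    proof (rule ccontr)
      assume "d \<notin> {a, b, c}"
      then have "(d, a) \<in> E" "(d, b) \<in> E"
        using uniq[of a b d] uniq[of b c d] semi[of a d] semi[of b d] abc AV d by blast+
      then show False using uniq[of d a b] abc d by auto
    qed
  qed
  then have A3: "A = {a, b, c}" using abc by auto
  have out: "E `` {a} = {v, b}" if abc: "a \<in> A" "b \<in> A" "c \<in> A" "a \<noteq> b" "b \<noteq> c" "a \<noteq> c" "(a, b) \<in> E" "(b, c) \<in> E"
    for a b c
  proof
    show "{v, b} \<subseteq> E `` {a}" using inA abc by auto
    have ent: "s = a \<and> (t = v \<or> t = b)" if "(s, t) \<in> E" "s \<notin> X a" "t \<in> X a" for s t
      using enter[OF abc(1) that] eq_e[OF abc(1,2,7)] by auto
    \<comment> \<open>A second such \<open>z\<close> could not dominate \<open>b\<close>, as that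
      arc would enter \<open>X a\<close>. Hence \<open>b\<close> dominates \<open>z\<close>, which
      lies in \<open>X b\<close> by \<open>cover\<close>, and this arc enters \<open>X b\<close>
      although \<open>z\<close> is neither \<open>v\<close> nor \<open>c\<close>.\<close>
    have only: "z = a" if z: "z \<in> V2" "z \<notin> X a" for z
    proof (rule ccontr)
      assume za: "z \<noteq> a"
      have bX: "b \<in> X a" "c \<in> X a" using other_in abc by auto
      have zb: "z \<noteq> b" using z bX by auto
      have "(z, b) \<notin> E" using ent[of z b] z bX za by auto
      then have bz: "(b, z) \<in> E" using semi[of z b] z zb abc AV by auto
      have "z \<in> X b" using cover[of a b] abc z unfolding V_def by auto
      then have "z = v \<or> z = c"
        using enter[OF abc(2) bz X(3)[OF abc(2)]] eq_e[OF abc(2,3,8)] by auto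
      then show False using z vV bX by auto
    qed
    show "E `` {a} \<subseteq> {v, b}"
    proof
      fix z assume "z \<in> E `` {a}"
      then have z: "(a, z) \<in> E" by auto
      show "z \<in> {v, b}"
      proof (cases "z \<in> X a")
        case True
        then show ?thesis using ent[OF z X(3)[OF abc(1)]] by auto
      next
        case False
        have zV: "z \<in> V" "z \<noteq> a" using z EV irr by auto
        then have z1: "z \<in> V1" using only False unfolding V_def by auto
        \<comment> \<open>An out-neighbour \<open>z\<close> of \<open>a\<close> in \<open>V1\<close>
          outside \<open>X a\<close> would send an arc into \<open>X a\<close>, but only arcs from
          \<open>a\<close> enter that set.\<close>
        obtain t where t: "(z, t) \<in> E" "t \<in> V2" "t \<noteq> a" using out_other[OF z1] by auto
        then have "t \<in> X a" using only by auto
        then have "z = a" using ent[OF t(1) False] by auto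
        then show ?thesis using zV by auto
      qed
    qed
  qed
  have "E `` {a} = {v, b}" "E `` {b} = {v, c}" "E `` {c} = {v, a}"
    using out[OF abc] out[OF abc(2,3,1,5) abc(6)[symmetric] abc(4)[symmetric] abc(8) ca]
      out[OF abc(3,1,2) abc(6)[symmetric] abc(4) abc(5)[symmetric] ca abc(7)] .
  moreover have "a \<in> V2" "b \<in> V2" "c \<in> V2" using abc(1-3) AV by blast+
  ultimately show ?thesis
    using A3[unfolded A_def] abc(4-6) by - (intro exI conjI)
qed

lemma good_V1_V1:
  assumes u: "u \<in> V1" and v: "v \<in> V1"
  shows "arc_disjoint_reach V E u v"
proof (rule ccontr)
  assume ng: "\<not> arc_disjoint_reach V E u v"
  interpret d: split_relation_in V1 V2 "E\<inverse>" by (rule dual)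
  have ngd: "\<not> arc_disjoint_reach V (E\<inverse>) v u" using arc_disjoint_reach_converse ng by metis
  have crit': "\<forall>q. (q, v) \<in> E \<longrightarrow> \<not> two_arc_strong V (E - {(q, v)})"
    using good_if_strong_without_last[OF v u] ng by metis
  obtain q1 q2 q3 where q: "E\<inverse> `` {v} = {q1, q2, q3}" "q1 \<noteq> q2" "q2 \<noteq> q3" "q1 \<noteq> q3" "q1 \<in> V2" "q2 \<in> V2" "q3 \<in> V2"
    "E `` {q1} = {v, q2}" "E `` {q2} = {v, q3}" "E `` {q3} = {v, q1}"
    using all_last_critical[OF v crit'] by (elim exE conjE) (rule that)
  have crit: "\<forall>q. (q, u) \<in> E\<inverse> \<longrightarrow> \<not> two_arc_strong V (E\<inverse> - {(q, u)})"
    using d.good_if_strong_without_last[OF u v] ngd by metis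
  note ex_p = d.all_last_critical[OF u crit, unfolded converse_converse]
  \<comment> \<open>The triangle of the converse is read backwards, so in \<open>E\<close> it runs
    from \<open>p1\<close> to \<open>p2\<close> to \<open>p3\<close> to \<open>p1\<close>.\<close>
  obtain p1 p3 p2 where p: "E `` {u} = {p1, p3, p2}" "p1 \<noteq> p3" "p3 \<noteq> p2" "p1 \<noteq> p2" "p1 \<in> V2" "p3 \<in> V2" "p2 \<in> V2"
    "E\<inverse> `` {p1} = {u, p3}" "E\<inverse> `` {p3} = {u, p2}" "E\<inverse> `` {p2} = {u, p1}"
    using ex_p by (elim exE conjE) (rule that)
  define A where "A = {q1, q2, q3}"
  define P where "P = {p1, p2, p3}"
  have AV: "A \<subseteq> V2" "P \<subseteq> V2" using p q unfolding A_def P_def by auto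
  have cA: "card A = 3" "card P = 3" using p q unfolding A_def P_def by auto
  have Av: "(z, v) \<in> E" if "z \<in> A" for z using that q(1) unfolding A_def by auto
  have Pu: "(u, z) \<in> E" if "z \<in> P" for z using that p(1) unfolding P_def by auto
  have nV1: "z \<notin> V1" "z \<noteq> u" "z \<noteq> v" if "z \<in> V2" for z using that disj u v by auto
  have Aout: "z \<in> insert v A" if "(a, z) \<in> E" "a \<in> A" for a z using that q(8-10) unfolding A_def by auto
  have Pin: "z \<in> insert u P" if "(z, a) \<in> E" "a \<in> P" for a z using that p(8-10) unfolding P_def by auto
  have finV2: "finite V2" using fin unfolding V_def by auto
  show False
  proof (cases "A \<inter> P = {}")
    case False
    \<comment> \<open>A common vertex \<open>r\<close> has one in-neighbour besides \<open>u\<close>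
      and one out-neighbour besides \<open>v\<close>, so \<open>V2\<close> has just three
      vertices.\<close>
    then obtain r where r: "r \<in> A" "r \<in> P" by auto
    then obtain s t where st: "E `` {r} = {v, s}" "E\<inverse> `` {r} = {u, t}"
      using p(8-10) q(8-10) unfolding A_def P_def by blast
    have "V2 \<subseteq> {r, s, t}"
    proof
      fix z assume z: "z \<in> V2"
      then have "z = r \<or> (r, z) \<in> E \<or> (z, r) \<in> E" using semi[of z r] r AV by auto
      then show "z \<in> {r, s, t}" using st nV1[OF z] by auto
    qed
    then have "card V2 \<le> card {r, s, t}" by (intro card_mono) auto
    also have "\<dots> \<le> 3" by (simp add: card_insert_if)
    finally have eq: "A = V2" "P = V2" using card_seteq[OF finV2] AV cA by auto
    \<comment> \<open>An out-arc of a vertex in \<open>V1\<close> ends in \<open>V2 = P\<close>,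
      which only \<open>u\<close> can enter from outside; in particular
      \<open>v = u\<close>.\<close>
    have V1u: "x = u" if x: "x \<in> V1" for x
    proof -
      obtain b where "(x, b) \<in> E" "b \<in> V2" using out_other[OF x] by auto
      then show ?thesis using Pin[of x b] eq x disj by auto
    qed
    have "arc_disjoint_reach V E u v"
    proof (rule good_if_colouring_of_V2[of "{u} \<times> V2" "V2 \<times> {v}"])
      show "{u} \<times> V2 \<subseteq> E" "V2 \<times> {v} \<subseteq> E" "{u} \<times> V2 \<inter> V2 \<times> {v} = {}"
        using Pu Av eq nV1 by auto
      show "(u, x) \<in> ({u} \<times> V2)\<^sup>*" if "x \<in> V2" for x using that by auto
      show "(x, v) \<in> (V2 \<times> {v})\<^sup>*" if "x \<in> V2" for x using that by auto
    qed (use V1u v in auto)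
    then show False using ng by simp
  next
    case True
    \<comment> \<open>From the rest of \<open>V2\<close> no arc enters \<open>P\<close>, and none
      leaves \<open>A\<close> for it; so \<open>P\<close> dominates the rest of \<open>V2\<close>,
      and dually the rest dominates \<open>A\<close>.\<close>
    have PA: "(a, b) \<in> E" if "a \<in> P" "b \<in> V2 - P" for a b
      using semi[of a b] Pin[of b a] that AV nV1[of b] by auto
    have ZA: "(a, b) \<in> E" if "a \<in> V2 - A" "b \<in> A" for a b
      using semi[of a b] Aout[of b a] that AV nV1[of a] by auto
    \<comment> \<open>Red spreads from \<open>p1\<close> and reaches \<open>v\<close> through
      \<open>q1\<close>; blue gathers in \<open>q2\<close> and leaves \<open>u\<close> through
      \<open>p3\<close>. The triangle arcs connect the vertices missed in this way.\<close>
    define Red where "Red = {(u, p1), (u, p2), (p2, p3), (q1, v)} \<union> {p1} \<times> (V2 - P)"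
    define Blue where "Blue = {(u, p3), (p1, p2), (p2, q1), (p3, q1), (q1, q2), (q2, v), (q3, v)} \<union> (V2 - P - A) \<times> {q2}"
    have arcs: "(p2, p3) \<in> E" "(p1, p2) \<in> E" "(q1, q2) \<in> E" using p(9,10) q(8) by auto
    have inA: "q1 \<in> A" "q2 \<in> A" "q3 \<in> A" and inP: "p1 \<in> P" "p2 \<in> P" "p3 \<in> P" unfolding A_def P_def by auto
    have nq: "q1 \<notin> P" "q2 \<notin> P" "q3 \<notin> P" "p1 \<notin> A" "p2 \<notin> A" "p3 \<notin> A" using inA inP True by auto
    have ne: "p1 \<noteq> u" "p2 \<noteq> u" "p3 \<noteq> u" "q1 \<noteq> u" "q2 \<noteq> u" "q3 \<noteq> u" "p1 \<noteq> v" "p2 \<noteq> v" "p3 \<noteq> v" "q1 \<noteq> v" "q2 \<noteq> v" "q3 \<noteq> v"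
      using nV1 p(5-7) q(5-7) by auto
    have "arc_disjoint_reach V E u v"
    proof (rule good_if_colouring_of_V2[of Red Blue])
      show "Red \<subseteq> E" using Pu Av arcs PA inA inP unfolding Red_def by auto
      show "Blue \<subseteq> E" using Pu Av arcs PA[of p2 q1] PA[of p3 q1] ZA inA inP nq q(5) unfolding Blue_def by auto
      show "Red \<inter> Blue = {}" using p(2-4) q(2-4) nq inA inP ne nV1(2)[of u] unfolding Red_def Blue_def by auto
      have R: "(u, p1) \<in> Red" "(u, p2) \<in> Red" "(p2, p3) \<in> Red" "\<And>z. z \<in> V2 - P \<Longrightarrow> (p1, z) \<in> Red" "(q1, v) \<in> Red"
        unfolding Red_def by auto
      have R': "(u, x) \<in> Red\<^sup>*" if "x \<in> V2 - P" for x using R(1) R(4)[OF that] by (meson r_into_rtrancl rtrancl_into_rtrancl)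
      have "(u, p3) \<in> Red\<^sup>*" using R by (meson r_into_rtrancl rtrancl_into_rtrancl)
      then have RP: "(u, x) \<in> Red\<^sup>*" if "x \<in> P" for x using that R(1,2) unfolding P_def by auto
      show "(u, x) \<in> Red\<^sup>*" if "x \<in> V2" for x using that R' RP by (cases "x \<in> P") auto
      have B: "(u, p3) \<in> Blue" "(p1, p2) \<in> Blue" "(p2, q1) \<in> Blue" "(p3, q1) \<in> Blue" "(q1, q2) \<in> Blue" "(q2, v) \<in> Blue" "(q3, v) \<in> Blue"
        "\<And>z. z \<in> V2 - P - A \<Longrightarrow> (z, q2) \<in> Blue"
        unfolding Blue_def by auto
      have q2: "(q2, v) \<in> Blue\<^sup>*" and q3: "(q3, v) \<in> Blue\<^sup>*" using B by auto
      have q1: "(q1, v) \<in> Blue\<^sup>*" using B(5) q2 by (rule converse_rtrancl_into_rtrancl)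
      have p3: "(p3, v) \<in> Blue\<^sup>*" using B(4) q1 by (rule converse_rtrancl_into_rtrancl)
      have p2: "(p2, v) \<in> Blue\<^sup>*" using B(3) q1 by (rule converse_rtrancl_into_rtrancl)
      have p1: "(p1, v) \<in> Blue\<^sup>*" using B(2) p2 by (rule converse_rtrancl_into_rtrancl)
      have ub: "(u, v) \<in> Blue\<^sup>*" using B(1) p3 by (rule converse_rtrancl_into_rtrancl)
      have z: "(z, v) \<in> Blue\<^sup>*" if "z \<in> V2 - P - A" for z using B(8)[OF that] q2 by (rule converse_rtrancl_into_rtrancl)
      show "(x, v) \<in> Blue\<^sup>*" if "x \<in> V2" for x
        using that z[of x] q1 q2 q3 p1 p2 p3 unfolding A_def P_def by auto
      have v_red: "(u, v) \<in> Red\<^sup>*" using R'[of q1] R(5) q(5) nq by (auto intro: rtrancl_into_rtrancl)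
      show "(u, x) \<in> Red\<^sup>* \<or> (\<exists>a. (a, x) \<in> E - Blue)" if x: "x \<in> V1" for x
      proof (cases "x = v")
        case True then show ?thesis using v_red by auto
      next
        case False
        have "x \<noteq> z" if "z \<in> V2" for z using that x disj by auto
        then show ?thesis using in_other[OF x] False p(5-7) q(5-7) unfolding Blue_def by auto
      qed
      show "(x, v) \<in> Blue\<^sup>* \<or> (\<exists>b. (x, b) \<in> E - Red)" if x: "x \<in> V1" for x
      proof (cases "x = u")
        case True then show ?thesis using ub by auto
      next
        case False
        have "x \<noteq> z" if "z \<in> V2" for z using that x disj by auto
        then show ?thesis using out_other[OF x] False p(5-7) q(5-7) unfolding Red_def by auto
      qed
    qed
    then show False using ng by simp
  qed
qed

theorem good_all:
  assumes "V1 \<noteq> {}" "u \<in> V" "v \<in> V"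
  shows "arc_disjoint_reach V E u v"
proof -
  interpret d: split_relation_in V1 V2 "E\<inverse>" by (rule dual)
  have "arc_disjoint_reach V E u v" if "u \<in> V2" "v \<in> V1"
    by (rule arc_disjoint_reach_converse[OF d.good_V1_V2[OF that(2,1)]])
  then show ?thesis using assms good_V2_V2 good_V1_V1 good_V1_V2 unfolding V_def by auto
qed

end

section \<open>From reachability to branchings\<close>

lemma no_cycle_in_forest:
  fixes f :: "'a \<Rightarrow> nat" and p :: "('a \<times> 'a) list"
  assumes n: "3 \<le> length p" and dist: "distinct (map snd p)"
    and closed: "\<And>i. i < length p \<Longrightarrow> fst (p ! (Suc i mod length p)) = snd (p ! i)"
    and arcs: "set p \<subseteq> F \<union> F\<inverse>" and sv: "single_valued (F\<inverse>)"
    and f: "\<And>a b. (a, b) \<in> F \<Longrightarrow> f a < f b"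
  shows False
proof -
  let ?n = "length p"
  \<comment> \<open>Both neighbours on the cycle of a vertex maximising \<open>f\<close> are its parent.\<close>
  let ?M = "(\<lambda>i. f (snd (p ! i))) ` {..<?n}"
  have "0 < ?n" using n by linarith
  then have "f (snd (p ! 0)) \<in> ?M" by (intro imageI) simp
  then have "?M \<noteq> {}" by blast
  then have "Max ?M \<in> ?M" by (intro Max_in) simp_all
  then obtain k where k0: "Max ?M = f (snd (p ! k))" "k \<in> {..<?n}" by (rule imageE)
  then have kn: "k < ?n" by simp
  have k: "f (snd (p ! i)) \<le> f (snd (p ! k))" if "i < ?n" for i
    unfolding k0(1)[symmetric] using that by (intro Max_ge) auto
  define j where "j = Suc k mod ?n"
  \<comment> \<open>The cyclic predecessor of \<open>k\<close>, as \<open>j\<close> is its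
    successor; they differ because the cycle has length at least three.\<close>
  define m where "m = (if k = 0 then ?n - 1 else k - 1)"
  have jm: "j < ?n" "m < ?n" "Suc m mod ?n = k" "j \<noteq> m"
    using kn n unfolding j_def m_def by (auto simp: mod_Suc)
  have F: "(b, a) \<in> F" if "(a, b) \<in> F \<union> F\<inverse>" "f b \<le> f a" for a b
    using that f[of a b] by auto
  have eqs: "(snd (p ! k), snd (p ! j)) = p ! j" "(snd (p ! m), snd (p ! k)) = p ! k"
    using closed[OF kn] closed[OF jm(2)] jm(3) unfolding j_def by (simp_all add: prod_eq_iff)
  have "(snd (p ! k), snd (p ! j)) \<in> F \<union> F\<inverse>" "(snd (p ! m), snd (p ! k)) \<in> F \<union> F\<inverse>"
    unfolding eqs using arcs nth_mem[OF jm(1)] nth_mem[OF kn] by blast+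
  moreover from this(1) have "(snd (p ! j), snd (p ! k)) \<in> F" using k[OF jm(1)] F by blast
  moreover from calculation(2) have "(snd (p ! m), snd (p ! k)) \<in> F"
    using k[OF jm(2)] f[of "snd (p ! k)" "snd (p ! m)"] by auto
  ultimately have "snd (p ! j) = snd (p ! m)" by (intro single_valuedD[OF sv]) auto
  then show False using nth_eq_iff_index_eq[OF dist, of j m] jm by simp
qed

section \<open>Oriented trees and branchings as spanning subdigraphs\<close>

definition sub_arcs :: "('a, 'b) pre_digraph \<Rightarrow> 'a rel \<Rightarrow> ('a, 'b) pre_digraph" where
  "sub_arcs D P = D\<lparr>arcs := {e \<in> arcs D. arc_to_ends D e \<in> P}\<rparr>"

lemma sub_arcs_simps [simp]:
  "verts (sub_arcs D P) = verts D" "tail (sub_arcs D P) = tail D" "head (sub_arcs D P) = head D"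
  "arcs (sub_arcs D P) = {e \<in> arcs D. arc_to_ends D e \<in> P}"
  unfolding sub_arcs_def by auto

lemma arcs_ends_sub_arcs:
  assumes "P \<subseteq> arcs_ends D"
  shows "arcs_ends (sub_arcs D P) = P"
proof -
  have "arc_to_ends (sub_arcs D P) = arc_to_ends D" by (simp add: arc_to_ends_def fun_eq_iff)
  then have "arcs_ends (sub_arcs D P) = arc_to_ends D ` {e \<in> arcs D. arc_to_ends D e \<in> P}"
    by (simp add: arcs_ends_def)
  then show ?thesis using assms unfolding arcs_ends_def by auto
qed

lemma arcs_ends_mk_symmetric:
  "arcs_ends (with_proj (mk_symmetric T)) = arcs_ends T \<union> (arcs_ends T)\<inverse>"
  by (auto simp: mk_symmetric_def arcs_ends_def arc_to_ends_def image_iff)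

lemma walk_consecutive:
  assumes "pre_digraph.cas G u p v" "Suc i < length p"
  shows "tail G (p ! Suc i) = head G (p ! i)"
  using assms
proof (induction p arbitrary: u i)
  case (Cons e p)
  show ?case
  proof (cases i)
    case 0
    then show ?thesis using Cons.prems by (cases p) (auto simp: pre_digraph.cas.simps)
  next
    case (Suc j)
    then show ?thesis using Cons by (auto simp: pre_digraph.cas.simps)
  qed
qed simp

lemma closed_walk_ends:
  assumes "pre_digraph.cas G u p v" "p \<noteq> []"
  shows "tail G (p ! 0) = u" "head G (p ! (length p - 1)) = v"
  using assms
proof (induction p arbitrary: u)
  case (Cons e p)
  {
    case 1 then show ?case by (auto simp: pre_digraph.cas.simps)
  next
    case 2 then show ?case using Cons.IH(2)[of "head G e"]
      by (cases p) (auto simp: pre_digraph.cas.simps)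
  }
qed auto

text \<open>Allowing \<open>P\<close> to be \<open>F\<close> or its converse covers both kinds of
  branching, because the underlying undirected graph is the same. The function \<open>f\<close>
  excludes opposite arcs and undirected cycles.\<close>

lemma (in digraph) sub_arcs_tree:
  fixes f :: "'a \<Rightarrow> nat"
  assumes P: "P \<subseteq> arcs_ends G" "P = F \<or> P = F\<inverse>" and sv: "single_valued (F\<inverse>)"
    and f: "\<And>a b. (a, b) \<in> F \<Longrightarrow> f a < f b" and r: "r \<in> verts G"
    and reach: "\<And>x. x \<in> verts G \<Longrightarrow> (r, x) \<in> F\<^sup>*"
  shows "spanning (sub_arcs G P) G" "oriented_tree (sub_arcs G P)"
proof -
  let ?T = "sub_arcs G P"
  let ?S = "with_proj (mk_symmetric ?T)"
  interpret T: digraph ?T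
  proof unfold_locales
    show "e = e'" if "e \<in> arcs ?T" "e' \<in> arcs ?T" "arc_to_ends ?T e = arc_to_ends ?T e'" for e e'
      using no_multi_arcs[of e e'] that by (simp add: arc_to_ends_def)
  qed (use no_loops in auto)
  show "spanning ?T G"
    unfolding spanning_def subgraph_def compatible_def
    using wf_digraph T.wf_digraph by auto
  have ends: "arcs_ends ?T = P" by (rule arcs_ends_sub_arcs[OF P(1)])
  have S: "arcs_ends ?S = F \<union> F\<inverse>" "verts ?S = verts G"
    using P(2) unfolding arcs_ends_mk_symmetric ends by (auto simp: mk_symmetric_def)
  interpret S: wf_digraph ?S
    by unfold_locales (auto simp: mk_symmetric_def)
  have "(x, y) \<in> (F \<union> F\<inverse>)\<^sup>*" if "x \<in> verts G" "y \<in> verts G" for x y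
  proof -
    have "(r, x) \<in> F\<^sup>*" "(r, y) \<in> F\<^sup>*" using reach that by auto
    then have "(x, r) \<in> (F \<union> F\<inverse>)\<^sup>*" "(r, y) \<in> (F \<union> F\<inverse>)\<^sup>*"
      using rtrancl_mono[of "F\<inverse>" "F \<union> F\<inverse>"] rtrancl_mono[of F "F \<union> F\<inverse>"]
      by (auto simp: rtrancl_converse)
    then show ?thesis by (rule rtrancl_trans)
  qed
  then have conn: "connected ?T"
    unfolding connected_def strongly_connected_def using r S S.reachable_conv by auto
  have acyc: False if cyc: "pre_digraph.cycle ?S p" and len: "3 \<le> length p" for p
  proof -
    obtain w where w: "pre_digraph.awalk ?S w p w" "distinct (tl (pre_digraph.awalk_verts ?S w p))"
      using cyc unfolding pre_digraph.cycle_def by auto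
    have cas: "pre_digraph.cas ?S w p w" and sub: "set p \<subseteq> arcs ?S"
      using w(1) unfolding pre_digraph.awalk_def by auto
    have "pre_digraph.awalk_verts ?S w p = tail ?S (hd p) # map (head ?S) p"
      using pre_digraph.awalk_verts_conv'[OF cas] len by auto
    then have dist: "distinct (map snd p)" using w(2) by simp
    have closed: "fst (p ! (Suc i mod length p)) = snd (p ! i)" if i: "i < length p" for i
    proof (cases "Suc i < length p")
      case True
      then show ?thesis using walk_consecutive[OF cas True] by simp
    next
      case False
      then have "Suc i = length p" using i by simp
      moreover have "p \<noteq> []" using len by auto
      moreover have "i = length p - 1" using calculation by simp
      ultimately show ?thesis using closed_walk_ends[OF cas] by simp
    qed
    have arcs: "set p \<subseteq> F \<union> F\<inverse>"
      using sub S(1) unfolding arcs_ends_def arc_to_ends_def by auto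
    show False by (rule no_cycle_in_forest[OF len dist closed arcs sv f])
  qed
  have "\<not> b \<rightarrow>\<^bsub>?T\<^esub> a" if "a \<rightarrow>\<^bsub>?T\<^esub> b" for a b
    using that P(2) f[of a b] f[of b a] unfolding ends by auto
  then show "oriented_tree ?T"
    unfolding oriented_tree_def using T.digraph_axioms conn acyc by blast
qed

lemma (in digraph) in_degree_sub_arcs:
  assumes a: "(a, w) \<in> P" "\<And>b. (b, w) \<in> P \<Longrightarrow> b = a" and P: "P \<subseteq> arcs_ends G"
  shows "in_degree (sub_arcs G P) w = 1"
proof -
  obtain e where e: "e \<in> arcs G" "arc_to_ends G e = (a, w)"
    using a(1) P unfolding arcs_ends_def by auto
  have "in_arcs (sub_arcs G P) w = {e}"
  proof (intro equalityI subsetI)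
    fix e' assume "e' \<in> in_arcs (sub_arcs G P) w"
    then have "e' \<in> arcs G" "arc_to_ends G e' = (a, w)" using a(2)[of "tail G e'"] by (auto simp: arc_to_ends_def)
    then show "e' \<in> {e}" using no_multi_arcs[of e' e] e by simp
  qed (use e a(1) in \<open>auto simp: arc_to_ends_def\<close>)
  then show ?thesis unfolding in_degree_def by simp
qed

lemma (in digraph) out_degree_sub_arcs:
  assumes a: "(w, a) \<in> P" "\<And>b. (w, b) \<in> P \<Longrightarrow> b = a" and P: "P \<subseteq> arcs_ends G"
  shows "out_degree (sub_arcs G P) w = 1"
proof -
  obtain e where e: "e \<in> arcs G" "arc_to_ends G e = (w, a)"
    using a(1) P unfolding arcs_ends_def by auto
  have "out_arcs (sub_arcs G P) w = {e}"
  proof (intro equalityI subsetI)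
    fix e' assume "e' \<in> out_arcs (sub_arcs G P) w"
    then have "e' \<in> arcs G" "arc_to_ends G e' = (w, a)" using a(2)[of "head G e'"] by (auto simp: arc_to_ends_def)
    then show "e' \<in> {e}" using no_multi_arcs[of e' e] e by simp
  qed (use e a(1) in \<open>auto simp: arc_to_ends_def\<close>)
  then show ?thesis unfolding out_degree_def by simp
qed

lemma (in digraph) out_branching_exists:
  assumes R: "R \<subseteq> arcs_ends G" and r: "r \<in> verts G" and reach: "\<And>x. x \<in> verts G \<Longrightarrow> (r, x) \<in> R\<^sup>*"
  obtains P where "P \<subseteq> R" "out_branching G r (sub_arcs G P)"
proof -
  obtain F f where F: "F \<subseteq> R" "single_valued (F\<inverse>)" "\<And>a b. (a, b) \<in> F \<Longrightarrow> (f a :: nat) < f b"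
    "R\<^sup>* `` {r} \<subseteq> F\<^sup>* `` {r}"
    using out_forest[of R "{r}"] by metis
  have rF: "(r, x) \<in> F\<^sup>*" if "x \<in> verts G" for x using F(4) reach[OF that] by auto
  have FG: "F \<subseteq> arcs_ends G" using F(1) R by auto
  have tree: "spanning (sub_arcs G F) G" "oriented_tree (sub_arcs G F)"
    by (rule sub_arcs_tree[OF FG _ F(2,3) r rF]; simp)+
  have "in_degree (sub_arcs G F) w = 1" if w: "w \<in> verts G" "w \<noteq> r" for w
  proof -
    obtain a where a: "(a, w) \<in> F" using rtranclE[OF rF[OF w(1)]] w(2) by blast
    have uniq: "b = a" if "(b, w) \<in> F" for b by (rule single_valuedD[OF F(2)]) (use that a in auto)
    then show ?thesis by (rule in_degree_sub_arcs[OF a _ FG])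
  qed
  then have "out_branching G r (sub_arcs G F)"
    unfolding out_branching_def using tree r by simp
  then show thesis using that[of F] F(1) by auto
qed

lemma (in digraph) in_branching_exists:
  assumes R: "R \<subseteq> arcs_ends G" and r: "r \<in> verts G" and reach: "\<And>x. x \<in> verts G \<Longrightarrow> (x, r) \<in> R\<^sup>*"
  obtains P where "P \<subseteq> R" "in_branching G r (sub_arcs G P)"
proof -
  obtain F f where F: "F \<subseteq> R\<inverse>" "single_valued (F\<inverse>)" "\<And>a b. (a, b) \<in> F \<Longrightarrow> (f a :: nat) < f b"
    "(R\<inverse>)\<^sup>* `` {r} \<subseteq> F\<^sup>* `` {r}"
    using out_forest[of "R\<inverse>" "{r}"] by metis
  have rF: "(r, x) \<in> F\<^sup>*" if "x \<in> verts G" for x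
    using F(4) reach[OF that] by (auto simp: rtrancl_converse)
  have FG: "F\<inverse> \<subseteq> arcs_ends G" using F(1) R by auto
  have tree: "spanning (sub_arcs G (F\<inverse>)) G" "oriented_tree (sub_arcs G (F\<inverse>))"
    by (rule sub_arcs_tree[OF FG _ F(2,3) r rF]; simp)+
  have "out_degree (sub_arcs G (F\<inverse>)) w = 1" if w: "w \<in> verts G" "w \<noteq> r" for w
  proof -
    obtain a where a: "(w, a) \<in> F\<inverse>" using rtranclE[OF rF[OF w(1)]] w(2) by blast
    have uniq: "b = a" if "(w, b) \<in> F\<inverse>" for b using that a by (rule single_valuedD[OF F(2)])
    then show ?thesis by (rule out_degree_sub_arcs[OF a _ FG])
  qed
  then have "in_branching G r (sub_arcs G (F\<inverse>))"
    unfolding in_branching_def using tree r by simp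
  then show thesis using that[of "F\<inverse>"] F(1) by auto
qed

section \<open>Translation of the hypotheses to the relation of end pairs\<close>

lemma (in digraph) two_arc_strong_arcs_ends:
  assumes "arc_strong 2 G"
  shows "two_arc_strong (verts G) (arcs_ends G)"
  unfolding two_arc_strong_def
proof (intro allI impI)
  fix X assume X: "X \<subseteq> verts G" "X \<noteq> {}" "X \<noteq> verts G"
  show "2 \<le> card (entering (arcs_ends G) X)"
  proof (rule ccontr)
    assume less: "\<not> 2 \<le> card (entering (arcs_ends G) X)"
    \<comment> \<open>Without parallel arcs \<open>S\<close> is as small as the cut, so it may be
      deleted; afterwards nothing outside \<open>X\<close> reaches \<open>X\<close>.\<close>
    define S where "S = {e \<in> arcs G. arc_to_ends G e \<in> entering (arcs_ends G) X}"
    have "arc_to_ends G ` S \<subseteq> entering (arcs_ends G) X" unfolding S_def by auto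
    moreover have "inj_on (arc_to_ends G) S"
      by (rule inj_on_subset[OF inj_on_arc_to_ends]) (auto simp: S_def)
    moreover have "finite (entering (arcs_ends G) X)" unfolding arcs_ends_def by auto
    ultimately have "card S \<le> card (entering (arcs_ends G) X)" by (intro card_inj_on_le)
    then have "card S < 2" using less by linarith
    moreover have "S \<subseteq> arcs G" "finite S" unfolding S_def by auto
    ultimately have sc: "strongly_connected (del_arcs G S)" using assms unfolding arc_strong_def by blast
    obtain x y where xy: "x \<in> X" "y \<in> verts G" "y \<notin> X" "x \<in> verts G" using X by blast
    then have "y \<rightarrow>\<^sup>*\<^bsub>del_arcs G S\<^esub> x" using sc unfolding strongly_connected_def del_arcs_def by auto
    then have "(y, x) \<in> (arcs_ends (del_arcs G S))\<^sup>*" by (rule reachable_rtranclI)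
    then have "entering (arcs_ends (del_arcs G S)) X \<noteq> {}" using xy by (intro entering_if_reachable) auto
    then obtain e where "e \<in> arcs G" "e \<notin> S" "arc_to_ends G e \<in> (- X) \<times> X"
      unfolding del_arcs_def arcs_ends_def arc_to_ends_def by auto
    then show False unfolding S_def arcs_ends_def by auto
  qed
qed

lemma (in digraph) out_degree_eq: "out_degree G x = card (arcs_ends G `` {x})"
proof -
  have "arcs_ends G `` {x} = head G ` out_arcs G x"
    unfolding arcs_ends_def arc_to_ends_def by (auto simp: image_iff)
  moreover have "inj_on (head G) (out_arcs G x)"
  proof (rule inj_onI)
    show "e = e'" if "e \<in> out_arcs G x" "e' \<in> out_arcs G x" "head G e = head G e'" for e e'
      using no_multi_arcs[of e e'] that by (simp add: arc_to_ends_def)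
  qed
  ultimately show ?thesis unfolding out_degree_def by (simp add: card_image)
qed

lemma (in digraph) in_degree_eq: "in_degree G x = card ((arcs_ends G)\<inverse> `` {x})"
proof -
  have "(arcs_ends G)\<inverse> `` {x} = tail G ` in_arcs G x"
    unfolding arcs_ends_def arc_to_ends_def by (auto simp: image_iff)
  moreover have "inj_on (tail G) (in_arcs G x)"
  proof (rule inj_onI)
    show "e = e'" if "e \<in> in_arcs G x" "e' \<in> in_arcs G x" "tail G e = tail G e'" for e e'
      using no_multi_arcs[of e e'] that by (simp add: arc_to_ends_def)
  qed
  ultimately show ?thesis unfolding in_degree_def by (simp add: card_image)
qed

theorem theorem4p2:
  fixes D :: "('a, 'b) pre_digraph" and V1 V2 :: "'a set"
  assumes "split_digraph D V1 V2"
    and "arc_strong 2 D"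
    and "\<forall>x \<in> V1. in_degree D x \<ge> 3 \<and> out_degree D x \<ge> 3"
  shows "\<forall>u \<in> verts D. \<forall>v \<in> verts D. \<exists>B_out B_in. good_pair D u v B_out B_in"
proof (intro ballI)
  fix u v assume uv: "u \<in> verts D" "v \<in> verts D"
  have D: "digraph D" "verts D = V1 \<union> V2" "V1 \<inter> V2 = {}" "V1 \<noteq> {}" "independent_in D V1" "semicomplete (D \<restriction> V2)"
    using assms(1) unfolding split_digraph_def by auto
  interpret digraph D by (rule D(1))
  let ?E = "arcs_ends D"
  have sub: "arcs_ends (D \<restriction> V2) \<subseteq> ?E" unfolding arcs_ends_def arc_to_ends_def by auto
  interpret split_relation_in V1 V2 ?E
  proof
    show "finite (V1 \<union> V2)" using finite_verts D(2) by simp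
    show "?E \<subseteq> (V1 \<union> V2) \<times> (V1 \<union> V2)" unfolding D(2)[symmetric] using adj_in_verts by auto
    show "(x, x) \<notin> ?E" for x using adj_not_same by auto
    show "(x, y) \<in> ?E \<or> (y, x) \<in> ?E" if "x \<in> V2" "y \<in> V2" "x \<noteq> y" for x y
      using D(6) sub that unfolding semicomplete_def by auto
    show "two_arc_strong (V1 \<union> V2) ?E" using two_arc_strong_arcs_ends[OF assms(2)] D(2) by simp
    show "3 \<le> card (?E `` {x})" "3 \<le> card (?E\<inverse> `` {x})" if "x \<in> V1" for x
      using assms(3) that out_degree_eq[of x] in_degree_eq[of x] by auto
  qed (use D in \<open>auto simp: independent_in_def\<close>)
  have V: "V = verts D" unfolding V_def D(2) ..
  obtain Red where Red: "Red \<subseteq> ?E" "\<forall>x\<in>V. (u, x) \<in> Red\<^sup>*" "\<forall>x\<in>V. (x, v) \<in> (?E - Red)\<^sup>*"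
    using good_all[of u v] D(4) uv unfolding arc_disjoint_reach_def V by auto
  obtain P where P: "P \<subseteq> Red" "out_branching D u (sub_arcs D P)"
    using out_branching_exists[OF Red(1) uv(1)] Red(2) unfolding V by auto
  obtain Q where Q: "Q \<subseteq> ?E - Red" "in_branching D v (sub_arcs D Q)"
    using in_branching_exists[of "?E - Red" v] uv(2) Red(3) unfolding V by auto
  have "arcs (sub_arcs D P) \<inter> arcs (sub_arcs D Q) = {}" using P(1) Q(1) by auto
  then show "\<exists>B_out B_in. good_pair D u v B_out B_in" unfolding good_pair_def using P(2) Q(2) by blast
qed

end
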